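(* Let $U_{a_2}(\mathcal S)$ be the Hopf algebra generated by $D,H,P,K,C,M$ with coproduct $\Delta(H)=1\otimes H+H\otimes1$, $\Delta(M)=1\otimes M+M\otimes1$, $\Delta(D)=1\otimes D+D\otimes e^{-2a_2H}$, $\Delta(C)=1\otimes C+C\otimes e^{-2a_2H}$, $\Delta(P)=1\otimes P+P\otimes e^{a_2H}$, $\Delta(K)=1\otimes K+K\otimes e^{-a_2H}+a_2D\otimes e^{-2a_2H}P$, and commutation rules $[D,P]=-P$, $[D,K]=K$, $[K,P]=M$, $[D,H]=\dfrac{e^{-2a_2H}-1}{a_2}$, $[D,C]=2C-a_2D^2$, $[H,C]=D$, $[K,H]=e^{-2a_2H}P$, $[K,C]=-\tfrac12a_2(KD+DK)$, $[M,\cdot]=0$, $[P,C]=-K+\tfrac12a_2(DP+PD)$, $[P,H]=0$. Then $$\mathcal R=\exp\{-a_2H\otimes D\}\exp\{a_2D\otimes H\}$$ is a triangular universal $R$-matrix for $U_{a_2}(\mathcal S)$; in particular it satisfies the quantum Yang–Baxter equation $\mathcal R_{12}\mathcal R_{13}\mathcal R_{23}=\mathcal R_{23}\mathcal R_{13}\mathcal R_{12}$ and $\mathcal R\,\Delta(X)\,\mathcal R^{-1}=\sigma\circ\Delta(X)$ for every $X\in U_{a_2}(\mathcal S)$. Its corresponding classical $r$-matrix is $r=a_2D\wedge H$.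
   Context: Everything is understood over formal power series $\mathbb R[[a_2]]$ with completed tensor products. $\sigma(X\otimes Y)=Y\otimes X$ and $X\wedge Y=X\otimes Y-Y\otimes X$. A universal $R$-matrix is an invertible $\mathcal R$ with $\mathcal R\Delta(X)\mathcal R^{-1}=\sigma\circ\Delta(X)$, $(\Delta\otimes\mathrm{id})\mathcal R=\mathcal R_{13}\mathcal R_{23}$, $(\mathrm{id}\otimes\Delta)\mathcal R=\mathcal R_{13}\mathcal R_{12}$; it is triangular if moreover $\sigma(\mathcal R)=\mathcal R^{-1}$. The corresponding classical $r$-matrix is the first-order term of $\mathcal R$ in the deformation parameter. *)

theory Defs
  imports
    "HOL-Analysis.Elementary_Topology"
    "HOL-Computational_Algebra.Formal_Power_Series"
    "HOL-Library.Poly_Mapping"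
    "HOL-Library.Product_Plus"
begin

unbundle fps_syntax

section \<open>Monoid algebras and formal power series over them\<close>

abbreviation (input) lookup where "lookup \<equiv> Poly_Mapping.lookup"
abbreviation (input) keys where "keys \<equiv> Poly_Mapping.keys"
abbreviation (input) single where "single \<equiv> Poly_Mapping.single"

lemma poly_sum_single: "p = (\<Sum>w\<in>keys p. single w (lookup p w))"
  by (rule poly_mapping_eqI)
     (auto simp: lookup_sum lookup_single when_def in_keys_iff sum.delta' cong: if_cong)

lemma poly_additive_induct [case_names single add]:
  fixes p :: "'w \<Rightarrow>\<^sub>0 real"
  assumes "\<And>w c. P (single w c)" "\<And>p q. P p \<Longrightarrow> P q \<Longrightarrow> P (p + q)"
  shows "P p"
proof -
  have "P 0" using assms(1)[of undefined 0] by simp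
  have "P (\<Sum>w\<in>A. single w (lookup p w))" if "finite A" for A
    using that by induction (use assms \<open>P 0\<close> in auto)
  from this[of "keys p"] show ?thesis by (simp flip: poly_sum_single)
qed

lemma single0_central: "single 0 c * p = p * single 0 (c :: real)" for p :: "'w::monoid_add \<Rightarrow>\<^sub>0 real"
  by (induction p rule: poly_additive_induct) (auto simp: mult_single algebra_simps)

definition push :: "('v \<Rightarrow> 'w) \<Rightarrow> ('v \<Rightarrow>\<^sub>0 real) \<Rightarrow> ('w \<Rightarrow>\<^sub>0 real)" where
  "push f p = (\<Sum>w\<in>keys p. single (f w) (lookup p w))"

definition fps_push :: "('v \<Rightarrow> 'w) \<Rightarrow> ('v \<Rightarrow>\<^sub>0 real) fps \<Rightarrow> ('w \<Rightarrow>\<^sub>0 real) fps" where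
  "fps_push f F = Abs_fps (\<lambda>n. push f (F $ n))"

text \<open>The central embedding of the ground ring \<open>\<real>[[a\<^sub>2]]\<close>.\<close>

definition fscal :: "real fps \<Rightarrow> ('w::monoid_add \<Rightarrow>\<^sub>0 real) fps" where
  "fscal c = Abs_fps (\<lambda>n. single 0 (c $ n))"

lemma push_eq: "finite A \<Longrightarrow> keys p \<subseteq> A \<Longrightarrow> push f p = (\<Sum>w\<in>A. single (f w) (lookup p w))"
  unfolding push_def by (rule sum.mono_neutral_left) (auto simp: in_keys_iff)

lemma push_add: "push f (p + q) = push f p + push f q"
proof -
  let ?A = "keys p \<union> keys q"
  have "keys (p + q) \<subseteq> ?A" by (rule keys_add)
  then show ?thesis
    by (simp add: push_eq[of ?A] lookup_add single_add sum.distrib)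
qed

lemma push_single: "push f (single w c) = single (f w) c"
  by (cases "c = 0") (simp_all add: push_def)

lemma push_mult:
  fixes f :: "'v::monoid_add \<Rightarrow> 'w::monoid_add"
  assumes "\<And>u v. f (u + v) = f u + f v"
  shows "push f (p * q) = push f p * push f q"
proof (induction p rule: poly_additive_induct)
  case (single w c)
  show ?case
    by (induction q rule: poly_additive_induct)
       (simp_all add: mult_single push_single assms push_add distrib_left)
qed (simp add: push_add distrib_right)

lemma push_0: "push f 0 = 0"
  by (simp add: push_def)

lemma push_sum: "push f (sum g A) = (\<Sum>i\<in>A. push f (g i))"
  by (induction A rule: infinite_finite_induct) (simp_all add: push_add push_0)

lemma fps_push_add: "fps_push f (F + G) = fps_push f F + fps_push f G"
  by (simp add: fps_eq_iff fps_push_def push_add)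

lemma fps_push_mult:
  fixes f :: "'v::monoid_add \<Rightarrow> 'w::monoid_add"
  assumes "\<And>u v. f (u + v) = f u + f v"
  shows "fps_push f (F * G) = fps_push f F * fps_push f G"
  by (simp add: fps_eq_iff fps_push_def fps_mult_nth push_sum push_mult[OF assms])

lemma fscal_nth [simp]: "fscal c $ n = single 0 (c $ n)"
  by (simp add: fscal_def)

lemma fscal_0 [simp]: "fscal 0 = 0" and fscal_1 [simp]: "fscal 1 = 1"
  by (simp_all add: fps_eq_iff)

lemma fscal_add: "fscal (c + d) = fscal c + fscal d"
  by (simp add: fps_eq_iff single_add)

lemma single_sum: "single k (sum g A) = (\<Sum>i\<in>A. single k (g i :: real))"
  by (induction A rule: infinite_finite_induct) (simp_all add: single_add)

lemma fscal_mult: "fscal (c * d) = fscal c * fscal d"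
  by (simp add: fps_eq_iff fps_mult_nth mult_single single_sum)

lemma fscal_central: "fscal c * F = F * fscal c"
proof (rule fps_ext)
  fix n
  have "(fscal c * F) $ n = (\<Sum>i=0..n. F $ (n - i) * single 0 (c $ i))"
    by (simp add: fps_mult_nth single0_central)
  also have "\<dots> = (\<Sum>i=0..n. F $ i * single 0 (c $ (n - i)))"
    by (rule sum.reindex_bij_witness[of _ "\<lambda>i. n - i" "\<lambda>i. n - i"]) auto
  also have "\<dots> = (F * fscal c) $ n"
    by (simp add: fps_mult_nth)
  finally show "(fscal c * F) $ n = (F * fscal c) $ n" .
qed

lemma fscal_left_commute: "F * (fscal c * G) = fscal c * (F * G)"
  by (metis fscal_central mult.assoc)

lemma fscal_X_power: "fscal (fps_X ^ k) = fps_X ^ k"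
  by (auto simp: fps_eq_iff fps_X_power_iff)

lemma fps_push_fscal:
  fixes f :: "'v::monoid_add \<Rightarrow> 'w::monoid_add"
  assumes "f 0 = 0"
  shows "fps_push f (fscal c) = fscal c"
  by (simp add: fps_eq_iff fps_push_def push_single assms)

lemma fps_split_at:
  fixes F :: "'b::ring_1 fps"
  shows "F = (\<Sum>k<n. fps_X ^ k * fps_const (F $ k)) + fps_X ^ n * fps_shift n F"
  (is "F = ?R")
proof (rule fps_ext)
  fix m
  have "(\<Sum>k<n. (fps_X ^ k * fps_const (F $ k)) $ m) = (\<Sum>k<n. if k = m then F $ m else 0)"
    by (rule sum.cong) (auto simp: fps_X_power_mult_nth)
  then show "F $ m = ?R $ m"
    by (auto simp: fps_sum_nth fps_X_power_mult_nth)
qed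

section \<open>Topological algebras given by generators and relations\<close>

text \<open>
  A presentation consists of a monoid \<open>'w\<close> of words and a set of relators in \<open>\<real>['w][[a\<^sub>2]]\<close>, where
  the variable \<open>fps_X\<close> plays the role of \<open>a\<^sub>2\<close>.  That the empty word is irreducible and that
  relators have no constant term is only required to make the presented algebra non-trivial,
  so that it is of class \<open>ring_1\<close>.
\<close>

class word_monoid = monoid_add +
  assumes add_eq_0D: "u + v = 0 \<Longrightarrow> u = 0 \<and> v = 0"

class presentation = word_monoid +
  fixes relators :: "('a \<Rightarrow>\<^sub>0 real) fps set"
  assumes relators_augmented: "r \<in> relators \<Longrightarrow> lookup (r $ n) 0 = 0"

inductive_set rel_ideal :: "('w::presentation \<Rightarrow>\<^sub>0 real) fps set" where
  zero: "0 \<in> rel_ideal"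
| relator: "r \<in> relators \<Longrightarrow> p * r * q \<in> rel_ideal"
| add: "x \<in> rel_ideal \<Longrightarrow> y \<in> rel_ideal \<Longrightarrow> x + y \<in> rel_ideal"

lemma rel_ideal_mult: "x \<in> rel_ideal \<Longrightarrow> p * x * q \<in> rel_ideal"
proof (induction rule: rel_ideal.induct)
  case zero show ?case by (simp add: rel_ideal.zero)
next
  case (relator r p' q')
  from rel_ideal.relator[OF this, of "p * p'" "q' * q"] show ?case by (simp add: mult.assoc)
next
  case (add x y) then show ?case by (simp add: distrib_left distrib_right rel_ideal.add)
qed

text \<open>\<open>closure\<close> refers to the \<open>a\<^sub>2\<close>-adic topology.\<close>

abbreviation rel_closure :: "('w::presentation \<Rightarrow>\<^sub>0 real) fps set" where
  "rel_closure \<equiv> closure rel_ideal"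

lemma closure_fps_iff:
  fixes S :: "'b::ring_1 fps set"
  shows "x \<in> closure S \<longleftrightarrow> (\<forall>n. \<exists>s\<in>S. \<exists>t. x = s + fps_X ^ n * t)"
proof
  assume x: "x \<in> closure S"
  show "\<forall>n. \<exists>s\<in>S. \<exists>t. x = s + fps_X ^ n * t"
  proof
    fix n
    have "open {H. fps_cutoff n H = fps_cutoff n x}" by (rule open_fps_cutoff)
    then obtain s where s: "s \<in> S" "fps_cutoff n s = fps_cutoff n x"
      using x by (auto simp: closure_iff_nhds_not_empty)
    then have "(x - s) $ k = 0" if "k < n" for k
      using that fps_cutoff_nth[of n s k] fps_cutoff_nth[of n x k] s(2) by simp
    then have "x = s + fps_X ^ n * fps_shift n (x - s)"
      by (auto simp: fps_eq_iff fps_X_power_mult_nth)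
    then show "\<exists>s\<in>S. \<exists>t. x = s + fps_X ^ n * t" using s(1) by blast
  qed
next
  assume R: "\<forall>n. \<exists>s\<in>S. \<exists>t. x = s + fps_X ^ n * t"
  show "x \<in> closure S"
    unfolding closure_iff_nhds_not_empty
  proof safe
    fix A V :: "'b fps set" assume A: "V \<subseteq> A" "open V" "x \<in> V" "S \<inter> A = {}"
    then obtain n where n: "{G. fps_cutoff n G = fps_cutoff n x} \<subseteq> V"
      unfolding open_fps_iff by blast
    from R obtain s t where "s \<in> S" "x = s + fps_X ^ n * t" by blast
    then have "fps_cutoff n s = fps_cutoff n x"
      by (auto simp: fps_eq_iff fps_X_power_mult_nth)
    with n A \<open>s \<in> S\<close> show False by blast
  qed
qed

lemma rel_closure_0: "0 \<in> rel_closure"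
  using closure_subset rel_ideal.zero by blast

lemma fps_X_power_central: "x * fps_X ^ n = fps_X ^ n * (x :: ('w::monoid_add \<Rightarrow>\<^sub>0 real) fps)"
  using fscal_central[of "fps_X ^ n" x] by (simp add: fscal_X_power)

lemma rel_closure_add: "x \<in> rel_closure \<Longrightarrow> y \<in> rel_closure \<Longrightarrow> x + y \<in> rel_closure"
  unfolding closure_fps_iff
proof
  fix n
  assume "\<forall>n. \<exists>s\<in>rel_ideal. \<exists>t. x = s + fps_X ^ n * t" "\<forall>n. \<exists>s\<in>rel_ideal. \<exists>t. y = s + fps_X ^ n * t"
  then obtain s t s' t' where "s \<in> rel_ideal" "s' \<in> rel_ideal" "x = s + fps_X ^ n * t" "y = s' + fps_X ^ n * t'"
    by meson
  then have "s + s' \<in> rel_ideal" "x + y = s + s' + fps_X ^ n * (t + t')"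
    by (auto simp: rel_ideal.add algebra_simps)
  then show "\<exists>s\<in>rel_ideal. \<exists>t. x + y = s + fps_X ^ n * t" by blast
qed

lemma rel_closure_mult: "x \<in> rel_closure \<Longrightarrow> p * x * q \<in> rel_closure"
  unfolding closure_fps_iff
proof
  fix n
  assume "\<forall>n. \<exists>s\<in>rel_ideal. \<exists>t. x = s + fps_X ^ n * t"
  then obtain s t where s: "s \<in> rel_ideal" "x = s + fps_X ^ n * t" by meson
  then have "p * x * q = p * s * q + fps_X ^ n * (p * t * q)"
    by (simp add: distrib_left distrib_right fps_X_power_central mult.assoc
             flip: fps_X_power_central[of p])
       (simp add: fps_X_power_central flip: mult.assoc)
  then show "\<exists>s\<in>rel_ideal. \<exists>t. p * x * q = s + fps_X ^ n * t"
    using rel_ideal_mult[OF s(1)] by blast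
qed

lemma rel_closure_uminus: "x \<in> rel_closure \<Longrightarrow> - x \<in> rel_closure"
  using rel_closure_mult[of x "-1" 1] by simp

lemma rel_closure_diff: "x \<in> rel_closure \<Longrightarrow> y \<in> rel_closure \<Longrightarrow> x - y \<in> rel_closure"
  using rel_closure_add[of x "- y"] rel_closure_uminus by auto

text \<open>The constant term is an algebra homomorphism that kills the relators.\<close>

lemma lookup_mult_0:
  fixes p q :: "'w::word_monoid \<Rightarrow>\<^sub>0 real"
  shows "lookup (p * q) 0 = lookup p 0 * lookup q 0"
proof (induction p rule: poly_additive_induct)
  case (single w c)
  show ?case
    by (induction q rule: poly_additive_induct)
       (auto simp: mult_single lookup_single when_def lookup_add algebra_simps dest: add_eq_0D)
qed (simp add: lookup_add algebra_simps)

lemma rel_ideal_augmented: "x \<in> rel_ideal \<Longrightarrow> lookup (x $ n) 0 = 0"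
proof (induction arbitrary: n rule: rel_ideal.induct)
  case (relator r p q)
  show ?case
    by (simp add: fps_mult_nth lookup_sum lookup_mult_0 relators_augmented[OF relator]
        sum_distrib_right)
qed (simp_all add: lookup_add)

lemma one_notin_rel_closure: "1 \<notin> rel_closure"
proof
  assume "1 \<in> (rel_closure :: ('a::presentation \<Rightarrow>\<^sub>0 real) fps set)"
  then obtain s :: "('a \<Rightarrow>\<^sub>0 real) fps" and t where "s \<in> rel_ideal" "1 = s + fps_X ^ 1 * t"
    unfolding closure_fps_iff by blast
  then have "1 $ 0 = s $ 0" by (metis add.right_neutral fps_add_nth fps_X_power_mult_nth less_one)
  with rel_ideal_augmented[OF \<open>s \<in> rel_ideal\<close>, of 0] show False
    by (simp add: lookup_one)
qed

quotient_type (overloaded) 'w calg = "('w::presentation \<Rightarrow>\<^sub>0 real) fps" / "\<lambda>x y. x - y \<in> rel_closure"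
proof (rule equivpI)
  show "reflp (\<lambda>x y::('w \<Rightarrow>\<^sub>0 real) fps. x - y \<in> rel_closure)"
    by (auto intro!: reflpI rel_closure_0)
  show "symp (\<lambda>x y::('w \<Rightarrow>\<^sub>0 real) fps. x - y \<in> rel_closure)"
    by (auto intro!: sympI dest: rel_closure_uminus)
  show "transp (\<lambda>x y::('w \<Rightarrow>\<^sub>0 real) fps. x - y \<in> rel_closure)"
    by (rule transpI) (use rel_closure_add in force)
qed

lemma abs_calg_cases [cases type: calg]:
  obtains F where "x = abs_calg F"
  using Quotient3_abs_rep[OF Quotient3_calg, of x] by metis

lemma rep_abs_calg: "rep_calg (abs_calg F) - F \<in> rel_closure"
  using Quotient3_abs_rep[OF Quotient3_calg, of "abs_calg F"] by (simp add: calg.abs_eq_iff)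

instantiation calg :: (presentation) ring_1
begin

lift_definition zero_calg :: "'a calg" is 0 .
lift_definition one_calg :: "'a calg" is 1 .
lift_definition plus_calg :: "'a calg \<Rightarrow> 'a calg \<Rightarrow> 'a calg" is "(+)"
  using rel_closure_add by (metis add_diff_add)
lift_definition minus_calg :: "'a calg \<Rightarrow> 'a calg \<Rightarrow> 'a calg" is "(-)"
proof -
  fix x x' y y' :: "('a \<Rightarrow>\<^sub>0 real) fps"
  assume "x - x' \<in> rel_closure" "y - y' \<in> rel_closure"
  then have "(x - x') - (y - y') \<in> rel_closure" by (rule rel_closure_diff)
  then show "x - y - (x' - y') \<in> rel_closure" by (simp add: algebra_simps)
qed
lift_definition uminus_calg :: "'a calg \<Rightarrow> 'a calg" is uminus
proof -
  fix x x' :: "('a \<Rightarrow>\<^sub>0 real) fps"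
  assume "x - x' \<in> rel_closure"
  then have "- (x - x') \<in> rel_closure" by (rule rel_closure_uminus)
  then show "- x - - x' \<in> rel_closure" by simp
qed
lift_definition times_calg :: "'a calg \<Rightarrow> 'a calg \<Rightarrow> 'a calg" is "(*)"
proof -
  fix x x' y y' :: "('a \<Rightarrow>\<^sub>0 real) fps"
  assume "x - x' \<in> rel_closure" "y - y' \<in> rel_closure"
  then have "1 * (x - x') * y + x' * (y - y') * 1 \<in> rel_closure"
    by (intro rel_closure_add rel_closure_mult)
  then show "x * y - x' * y' \<in> rel_closure" by (simp add: algebra_simps)
qed

instance
proof
  show "(0 :: 'a calg) \<noteq> 1"
    by transfer (use one_notin_rel_closure rel_closure_uminus in force)
qed (transfer; simp add: algebra_simps rel_closure_0)+

end


lift_definition scal :: "real fps \<Rightarrow> 'w::presentation calg" is fscal .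

abbreviation a\<^sub>2 :: "'w::presentation calg" where "a\<^sub>2 \<equiv> scal fps_X"

definition cscale :: "real fps \<Rightarrow> 'w::presentation calg \<Rightarrow> 'w calg" (infixr \<open>*\<^sub>R\<^sub>a\<close> 75)
  where "c *\<^sub>R\<^sub>a x = scal c * x"

lemma scal_0 [simp]: "scal 0 = 0" and scal_1 [simp]: "scal 1 = 1"
  by (transfer; simp add: rel_closure_0)+

lemma scal_abs: "scal c * abs_calg F = abs_calg (fscal c * F)"
  by (simp add: scal.abs_eq times_calg.abs_eq)

lemma scal_add: "scal (c + d) = scal c + scal d"
  by transfer (simp add: fscal_add rel_closure_0)

lemma scal_mult: "scal (c * d) = scal c * scal d"
  by transfer (simp add: fscal_mult rel_closure_0)

lemma scal_power: "scal (c ^ n) = scal c ^ n"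
  by (induction n) (simp_all add: scal_mult)

lemma scal_central: "scal c * x = x * scal c"
  by transfer (simp add: fscal_central rel_closure_0)

lemma scal_left_commute: "x * (scal c * y) = scal c * (x * y)"
  by (metis scal_central mult.assoc)

lemma module_cscale: "module cscale"
  by standard (simp_all add: cscale_def distrib_left distrib_right scal_add scal_mult mult.assoc)

lemma module_ground: "module ((*) :: real fps \<Rightarrow> real fps \<Rightarrow> real fps)"
  by standard (simp_all add: algebra_simps)

lemma calg_separated:
  assumes "\<And>n. \<exists>y. x = scal (fps_X ^ n) * y"
  shows "x = (0 :: 'w::presentation calg)"
proof -
  obtain F where x: "x = abs_calg F" by (rule abs_calg_cases)
  have "F \<in> rel_closure"
    unfolding closure_fps_iff
  proof
    fix n
    obtain y where "x = scal (fps_X ^ n) * y" using assms by blast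
    moreover obtain G where "y = abs_calg G" by (rule abs_calg_cases)
    ultimately have "abs_calg F = abs_calg (fps_X ^ n * G)"
      by (simp add: x scal.abs_eq times_calg.abs_eq fscal_X_power)
    then have "F - fps_X ^ n * G \<in> rel_closure"
      by (simp add: calg.abs_eq_iff)
    then obtain s t where "s \<in> rel_ideal" "F - fps_X ^ n * G = s + fps_X ^ n * t"
      unfolding closure_fps_iff by blast
    then have "s \<in> rel_ideal" "F = s + fps_X ^ n * (t + G)"
      by (auto simp: algebra_simps)
    then show "\<exists>s\<in>rel_ideal. \<exists>t. F = s + fps_X ^ n * t" by blast
  qed
  then show ?thesis by (simp add: x zero_calg.abs_eq calg.abs_eq_iff)
qed

text \<open>The quotient of the \<open>a\<^sub>2\<close>-adic topology.\<close>

instantiation calg :: (presentation) t2_space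
begin

definition open_calg :: "'a calg set \<Rightarrow> bool"
  where "open_calg U \<longleftrightarrow> open (abs_calg -` U)"

instance
proof
  show "open (UNIV :: 'a calg set)" by (simp add: open_calg_def)
  show "open (S \<inter> T)" if "open S" "open T" for S T :: "'a calg set"
    using that by (auto simp: open_calg_def vimage_Int)
  show "open (\<Union>K)" if "\<forall>S\<in>K. open S" for K :: "'a calg set set"
    using that by (auto simp: open_calg_def vimage_Union)
  fix x y :: "'a calg"
  assume "x \<noteq> y"
  then obtain n where n: "\<nexists>z. x - y = scal (fps_X ^ n) * z"
    using calg_separated[of "x - y"] by auto
  define B where "B = (\<lambda>x. {x + scal (fps_X ^ n) * z | z :: 'a calg. True})"
  have "open (B w)" for w
    unfolding open_calg_def open_fps_iff
  proof
    fix F assume "F \<in> abs_calg -` B w"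
    then obtain z where z: "abs_calg F = w + scal (fps_X ^ n) * z" by (auto simp: B_def)
    have "abs_calg G \<in> B w" if "fps_cutoff n G = fps_cutoff n F" for G
    proof -
      have "(G - F) $ k = 0" if "k < n" for k
        using that fps_cutoff_nth[of n F k] fps_cutoff_nth[of n G k] \<open>fps_cutoff n G = _\<close> by simp
      then have "G = F + fps_X ^ n * fps_shift n (G - F)"
        by (auto simp: fps_eq_iff fps_X_power_mult_nth)
      then have "abs_calg G = abs_calg (F + fscal (fps_X ^ n) * fps_shift n (G - F))"
        by (simp add: fscal_X_power)
      then have "abs_calg G = w + scal (fps_X ^ n) * (z + abs_calg (fps_shift n (G - F)))"
        by (simp add: z distrib_left add.assoc flip: plus_calg.abs_eq times_calg.abs_eq scal.abs_eq)
      then show ?thesis by (auto simp: B_def)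
    qed
    then show "\<exists>n. {G. fps_cutoff n G = fps_cutoff n F} \<subseteq> abs_calg -` B w" by blast
  qed
  moreover have "w \<in> B w" for w
    unfolding B_def by (auto intro!: exI[of _ 0])
  moreover have "B x \<inter> B y = {}"
  proof -
    have False if "x + scal (fps_X ^ n) * z = y + scal (fps_X ^ n) * z'" for z z'
    proof -
      have "x - y = scal (fps_X ^ n) * (z' - z)"
        using that by (simp add: algebra_simps)
      with n show False by blast
    qed
    then show ?thesis by (auto simp: B_def)
  qed
  ultimately show "\<exists>U V. open U \<and> open V \<and> x \<in> U \<and> y \<in> V \<and> U \<inter> V = {}"
    by blast
qed

end

text \<open>\<open>aexp x\<close> is $e^{a_2 x}$.\<close>

definition aexp :: "'w::presentation calg \<Rightarrow> 'w calg" where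
  "aexp x = suminf (\<lambda>n. scal (fps_const (1 / fact n) * fps_X ^ n) * x ^ n)"

lemma aadic_sums:
  fixes f :: "nat \<Rightarrow> ('w::presentation \<Rightarrow>\<^sub>0 real) fps"
  shows "(\<lambda>n. scal (fps_X ^ n) * abs_calg (f n)) sums
    abs_calg (Abs_fps (\<lambda>m. \<Sum>k\<le>m. f k $ (m - k)))"
  unfolding sums_def
proof (rule topological_tendstoI)
  let ?S = "Abs_fps (\<lambda>m. \<Sum>k\<le>m. f k $ (m - k))"
  fix U :: "'w calg set"
  assume "open U" "abs_calg ?S \<in> U"
  then obtain n where n: "\<And>G. fps_cutoff n G = fps_cutoff n ?S \<Longrightarrow> abs_calg G \<in> U"
    unfolding open_calg_def open_fps_iff by blast
  have eq: "(\<Sum>k<N. scal (fps_X ^ k) * abs_calg (f k)) = abs_calg (\<Sum>k<N. fps_X ^ k * f k)" for N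
    by (induction N)
       (simp_all add: zero_calg.abs_eq scal.abs_eq times_calg.abs_eq plus_calg.abs_eq fscal_X_power)
  have "fps_cutoff n (\<Sum>k<N. fps_X ^ k * f k) = fps_cutoff n ?S" if "N \<ge> n" for N
  proof (rule fps_ext)
    fix m
    show "fps_cutoff n (\<Sum>k<N. fps_X ^ k * f k) $ m = fps_cutoff n ?S $ m"
    proof (cases "m < n")
      case True
      have "(\<Sum>k<N. (fps_X ^ k * f k) $ m) = (\<Sum>k\<le>m. f k $ (m - k))"
        using True \<open>N \<ge> n\<close>
        by (intro sum.mono_neutral_cong_right) (auto simp: fps_X_power_mult_nth)
      then show ?thesis by (simp add: fps_sum_nth)
    qed simp
  qed
  then have "(\<Sum>k<N. scal (fps_X ^ k) * abs_calg (f k)) \<in> U" if "N \<ge> n" for N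
    using n that by (simp add: eq)
  then show "\<forall>\<^sub>F N in sequentially. (\<Sum>k<N. scal (fps_X ^ k) * abs_calg (f k)) \<in> U"
    by (auto simp: eventually_sequentially)
qed

lemma aexp_sums: "(\<lambda>n. scal (fps_const (1 / fact n) * fps_X ^ n) * x ^ n) sums aexp x"
proof -
  define f where "f n = rep_calg (scal (fps_const (1 / fact n)) * x ^ n)" for n
  have f: "abs_calg (f n) = scal (fps_const (1 / fact n)) * x ^ n" for n
    by (simp add: f_def Quotient3_abs_rep[OF Quotient3_calg])
  have "scal (fps_const (1 / fact n) * fps_X ^ n) * x ^ n = scal (fps_X ^ n) * abs_calg (f n)" for n
    by (subst mult.commute) (simp only: f scal_mult mult.assoc)
  then show ?thesis
    unfolding aexp_def using sums_summable[OF aadic_sums[of f]] by (simp add: summable_sums)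
qed

section \<open>Completed tensor products\<close>

text \<open>
  \<open>('v \<times> 'w) calg\<close> is the completed tensor product of \<open>'v calg\<close> and \<open>'w calg\<close>: it is generated
  by two commuting copies of the generators, subject to the relators of either factor.
  Lemma \<open>tlift\<close> below is its universal property.
\<close>

lemma lookup_push_0:
  assumes "\<And>w. f w = 0 \<longleftrightarrow> w = 0"
  shows "lookup (push f p) 0 = lookup p 0"
  by (induction p rule: poly_additive_induct)
     (auto simp: push_single push_add lookup_single when_def lookup_add assms)

instantiation prod :: (presentation, presentation) presentation
begin

definition relators_prod :: "('a \<times> 'b \<Rightarrow>\<^sub>0 real) fps set" where
  "relators_prod = fps_push (\<lambda>v. (v, 0)) ` relators \<union> fps_push (\<lambda>w. (0, w)) ` relators"

instance
proof
  fix u v :: "'a \<times> 'b"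
  assume "u + v = 0"
  then show "u = 0 \<and> v = 0"
    by (cases u; cases v) (auto simp: zero_prod_def dest: add_eq_0D)
next
  fix r :: "('a \<times> 'b \<Rightarrow>\<^sub>0 real) fps" and n
  assume "r \<in> relators"
  moreover have "lookup (push (\<lambda>v. (v, 0)) p) (0 :: 'a \<times> 'b) = lookup p 0" for p
    by (rule lookup_push_0) (simp add: zero_prod_def)
  moreover have "lookup (push (\<lambda>w. (0, w)) p) (0 :: 'a \<times> 'b) = lookup p 0" for p
    by (rule lookup_push_0) (simp add: zero_prod_def)
  ultimately show "lookup (r $ n) 0 = 0"
    by (auto simp: relators_prod_def fps_push_def relators_augmented)
qed

end

text \<open>Monoid homomorphisms that respect the relators induce algebra homomorphisms (\<open>cmap_abs\<close>).\<close>

definition cmap :: "('v \<Rightarrow> 'w) \<Rightarrow> 'v::presentation calg \<Rightarrow> 'w::presentation calg" where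
  "cmap f x = abs_calg (fps_push f (rep_calg x))"

definition tens :: "'v::presentation calg \<Rightarrow> 'w::presentation calg \<Rightarrow> ('v \<times> 'w) calg" (infixl \<open>\<otimes>\<close> 72)
  where "x \<otimes> y = cmap (\<lambda>v. (v, 0)) x * cmap (\<lambda>w. (0, w)) y"

definition flip :: "('v::presentation \<times> 'w::presentation) calg \<Rightarrow> ('w \<times> 'v) calg" where
  "flip = cmap (\<lambda>(v, w). (w, v))"

definition assoc ::
  "(('u::presentation \<times> 'v::presentation) \<times> 'w::presentation) calg \<Rightarrow> ('u \<times> 'v \<times> 'w) calg" where
  "assoc = cmap (\<lambda>((u, v), w). (u, v, w))"

definition leg12 :: "('w::presentation \<times> 'w) calg \<Rightarrow> ('w \<times> 'w \<times> 'w) calg" where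
  "leg12 = cmap (\<lambda>(u, v). (u, v, 0))"

definition leg13 :: "('w::presentation \<times> 'w) calg \<Rightarrow> ('w \<times> 'w \<times> 'w) calg" where
  "leg13 = cmap (\<lambda>(u, v). (u, 0, v))"

definition leg23 :: "('w::presentation \<times> 'w) calg \<Rightarrow> ('w \<times> 'w \<times> 'w) calg" where
  "leg23 = cmap (\<lambda>(u, v). (0, u, v))"

abbreviation clinear :: "('v::presentation calg \<Rightarrow> 'w::presentation calg) \<Rightarrow> bool" where
  "clinear \<equiv> module_hom cscale cscale"

definition cbilinear ::
  "('u::presentation calg \<Rightarrow> 'v::presentation calg \<Rightarrow> 'w::presentation calg) \<Rightarrow> bool" where
  "cbilinear B \<longleftrightarrow> (\<forall>x. clinear (B x)) \<and> (\<forall>y. clinear (\<lambda>x. B x y))"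

text \<open>
  Linear maps need not be required to be continuous: \<open>\<real>[[a\<^sub>2]]\<close>-linearity already implies
  continuity for the \<open>a\<^sub>2\<close>-adic topologies.
\<close>

definition tlift ::
  "('u::presentation calg \<Rightarrow> 'v::presentation calg \<Rightarrow> 'w::presentation calg) \<Rightarrow>
    ('u \<times> 'v) calg \<Rightarrow> 'w calg" where
  "tlift B = (THE h. clinear h \<and> (\<forall>x y. h (x \<otimes> y) = B x y))"

definition tmap ::
  "('u::presentation calg \<Rightarrow> 'u'::presentation calg) \<Rightarrow>
   ('v::presentation calg \<Rightarrow> 'v'::presentation calg) \<Rightarrow> ('u \<times> 'v) calg \<Rightarrow> ('u' \<times> 'v') calg" where
  "tmap f g = tlift (\<lambda>x y. f x \<otimes> g y)"

subsection \<open>Linear maps out of the free algebra\<close>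

definition mon :: "'w::presentation \<Rightarrow> 'w calg" where
  "mon w = abs_calg (fps_const (single w 1))"

definition flin :: "(('v::monoid_add \<Rightarrow>\<^sub>0 real) fps \<Rightarrow> 'w::presentation calg) \<Rightarrow> bool" where
  "flin T \<longleftrightarrow> (\<forall>F G. T (F + G) = T F + T G) \<and> (\<forall>c F. T (fscal c * F) = scal c * T F)"

lemma flin_add: "flin T \<Longrightarrow> T (F + G) = T F + T G"
  and flin_scal: "flin T \<Longrightarrow> T (fscal c * F) = scal c * T F"
  by (auto simp: flin_def)

lemma flin_0: "flin T \<Longrightarrow> T 0 = 0"
  using flin_scal[of T 0 0] by simp

lemma flin_diff: "flin T \<Longrightarrow> flin T' \<Longrightarrow> flin (\<lambda>F. T F - T' F)"
  by (auto simp: flin_def algebra_simps)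

lemma flin_abs: "flin abs_calg"
  by (simp add: flin_def plus_calg.abs_eq times_calg.abs_eq scal.abs_eq)

lemma flin_zeroI:
  assumes T: "flin T" and 0: "\<And>w. T (fps_const (single w 1)) = 0"
  shows "T F = 0"
proof -
  have const: "T (fps_const p) = 0" for p
  proof (induction p rule: poly_additive_induct)
    case (single w c)
    have "fps_const (single w c) = fscal (fps_const c) * fps_const (single w 1)"
      by (simp add: fps_eq_iff mult_single)
    then show ?case using T 0 by (simp add: flin_scal)
  next
    case (add p q)
    then show ?case using T by (simp add: flin_add flip: fps_const_add)
  qed
  have X: "T (fps_X ^ n * G) = scal (fps_X ^ n) * T G" for n G
    using flin_scal[OF T, of "fps_X ^ n" G] by (simp add: fscal_X_power)
  show ?thesis
  proof (rule calg_separated)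
    fix n
    have "T (\<Sum>k<n. fps_X ^ k * fps_const (F $ k)) = 0" for n
      by (induction n) (simp_all add: flin_0[OF T] flin_add[OF T] X const)
    then have "T F = scal (fps_X ^ n) * T (fps_shift n F)"
      using arg_cong[OF fps_split_at[of F n], of T] by (simp add: flin_add[OF T] X)
    then show "\<exists>y. T F = scal (fps_X ^ n) * y" by blast
  qed
qed

lemma flin_eqI:
  assumes "flin T" "flin T'" "\<And>w. T (fps_const (single w 1)) = T' (fps_const (single w 1))"
  shows "T F = T' F"
  using flin_zeroI[OF flin_diff[OF assms(1,2)], of F] assms(3) by simp

lemma flin_descends:
  assumes T: "flin T" and rel: "\<And>p r q. r \<in> relators \<Longrightarrow> T (p * r * q) = 0"
  shows "T (rep_calg (abs_calg F)) = T F"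
proof -
  have ideal: "T x = 0" if "x \<in> rel_ideal" for x
    using that by induction (simp_all add: flin_0[OF T] rel flin_add[OF T])
  have "T x = 0" if x: "x \<in> rel_closure" for x
  proof (rule calg_separated)
    fix n
    obtain s t where "s \<in> rel_ideal" "x = s + fps_X ^ n * t"
      using x unfolding closure_fps_iff by blast
    then have "T x = scal (fps_X ^ n) * T t"
      using flin_scal[OF T, of "fps_X ^ n" t] by (simp add: ideal flin_add[OF T] fscal_X_power)
    then show "\<exists>y. T x = scal (fps_X ^ n) * y" by blast
  qed
  from this[OF rep_abs_calg[of F]] flin_add[OF T, of "rep_calg (abs_calg F) - F" F]
  show ?thesis by simp
qed

lemma flin_exists:
  fixes \<phi> :: "'v::monoid_add \<Rightarrow> 'w::presentation calg"
  shows "\<exists>T. flin T \<and> (\<forall>w. T (fps_const (single w 1)) = \<phi> w)"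
proof -
  define \<psi> :: "('v \<Rightarrow>\<^sub>0 real) \<Rightarrow> ('w \<Rightarrow>\<^sub>0 real) fps" where
    "\<psi> p = (\<Sum>w\<in>keys p. fps_const (single 0 (lookup p w)) * rep_calg (\<phi> w))" for p
  have \<psi>_eq: "\<psi> p = (\<Sum>w\<in>A. fps_const (single 0 (lookup p w)) * rep_calg (\<phi> w))"
    if "finite A" "keys p \<subseteq> A" for p A
    unfolding \<psi>_def using that by (intro sum.mono_neutral_left) (auto simp: in_keys_iff)
  have \<psi>_add: "\<psi> (p + q) = \<psi> p + \<psi> q" for p q
  proof -
    let ?A = "keys p \<union> keys q"
    have "keys (p + q) \<subseteq> ?A" by (rule keys_add)
    then show ?thesis
      by (simp add: \<psi>_eq[of ?A] lookup_add single_add sum.distrib distrib_right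
          flip: fps_const_add)
  qed
  have \<psi>_0: "\<psi> 0 = 0" by (simp add: \<psi>_def)
  have \<psi>_sum: "\<psi> (sum g A) = (\<Sum>i\<in>A. \<psi> (g i))" for g and A :: "nat set"
    by (induction A rule: infinite_finite_induct) (simp_all add: \<psi>_add \<psi>_0)
  have \<psi>_single: "\<psi> (single w c) = fps_const (single 0 c) * rep_calg (\<phi> w)" for w c
    by (cases "c = 0") (simp_all add: \<psi>_def)
  have \<psi>_scale: "\<psi> (single 0 c * p) = fps_const (single 0 c) * \<psi> p" for c p
    by (induction p rule: poly_additive_induct)
       (simp_all add: \<psi>_add distrib_left mult_single \<psi>_single flip: mult.assoc)
  define T where "T F = abs_calg (Abs_fps (\<lambda>m. \<Sum>k\<le>m. \<psi> (F $ k) $ (m - k)))" for F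
  have "T (F + G) = T F + T G" for F G
    unfolding T_def plus_calg.abs_eq
    by (rule arg_cong[of _ _ abs_calg]) (simp add: fps_eq_iff \<psi>_add sum.distrib)
  moreover have "T (fscal c * F) = scal c * T F" for c F
    unfolding T_def scal.abs_eq times_calg.abs_eq
  proof (rule arg_cong[of _ _ abs_calg], rule fps_ext)
    fix m
    have "(\<Sum>k\<le>m. \<psi> ((fscal c * F) $ k) $ (m - k))
        = (\<Sum>k\<le>m. \<Sum>i\<le>k. single 0 (c $ i) * \<psi> (F $ (k - i)) $ (m - k))"
      by (simp add: fps_mult_nth[of "fscal c"] \<psi>_sum \<psi>_scale fps_sum_nth atLeast0AtMost)
    also have "\<dots> = (\<Sum>(k, i)\<in>(SIGMA k:{..m}. {..k}). single 0 (c $ i) * \<psi> (F $ (k - i)) $ (m - k))"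
      by (subst sum.Sigma) auto
    also have "\<dots> = (\<Sum>(i, l)\<in>(SIGMA i:{..m}. {..m - i}). single 0 (c $ i) * \<psi> (F $ l) $ (m - i - l))"
      by (rule sum.reindex_bij_witness[of _ "\<lambda>(i, l). (i + l, i)" "\<lambda>(k, i). (i, k - i)"]) auto
    also have "\<dots> = (\<Sum>i\<le>m. single 0 (c $ i) * (\<Sum>l\<le>m - i. \<psi> (F $ l) $ (m - i - l)))"
      by (subst sum.Sigma[symmetric]) (auto simp: sum_distrib_left)
    finally show "Abs_fps (\<lambda>m. \<Sum>k\<le>m. \<psi> ((fscal c * F) $ k) $ (m - k)) $ m
        = (fscal c * Abs_fps (\<lambda>m. \<Sum>k\<le>m. \<psi> (F $ k) $ (m - k))) $ m"
      by (simp add: fps_mult_nth atLeast0AtMost)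
  qed
  moreover have "T (fps_const (single w 1)) = \<phi> w" for w
  proof -
    have "(\<Sum>k\<le>m. \<psi> (fps_const (single w 1) $ k) $ (m - k)) = rep_calg (\<phi> w) $ m" for m
    proof -
      have "(\<Sum>k\<le>m. \<psi> (fps_const (single w 1) $ k) $ (m - k))
          = (\<Sum>k\<le>m. if k = 0 then \<psi> (single w 1) $ m else 0)"
        by (rule sum.cong) (auto simp: \<psi>_0)
      then show ?thesis by (simp add: \<psi>_single)
    qed
    then show ?thesis by (simp add: T_def fps_nth_inverse Quotient3_abs_rep[OF Quotient3_calg])
  qed
  ultimately show ?thesis unfolding flin_def by blast
qed

subsection \<open>Induced maps are well defined\<close>

definition pres_hom :: "('v::presentation \<Rightarrow> 'w::presentation) \<Rightarrow> bool" where
  "pres_hom f \<longleftrightarrow> f 0 = 0 \<and> (\<forall>u v. f (u + v) = f u + f v) \<and> (\<forall>r\<in>relators. fps_push f r \<in> relators)"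

lemma relator_in_closure: "r \<in> relators \<Longrightarrow> p * r * q \<in> rel_closure"
  using closure_subset rel_ideal.relator by blast

lemma flin_push: "f 0 = 0 \<Longrightarrow> (\<And>u v. f (u + v) = f u + f v) \<Longrightarrow> flin (\<lambda>F. abs_calg (fps_push f F))"
  by (simp add: flin_def fps_push_add fps_push_mult fps_push_fscal
      plus_calg.abs_eq times_calg.abs_eq scal.abs_eq)

lemma cmap_abs:
  assumes "pres_hom f"
  shows "cmap f (abs_calg F) = abs_calg (fps_push f F)"
  unfolding cmap_def
proof (rule flin_descends)
  show "flin (\<lambda>F. abs_calg (fps_push f F))"
    using assms by (intro flin_push) (auto simp: pres_hom_def)
  fix p q r :: "('a \<Rightarrow>\<^sub>0 real) fps"
  assume "r \<in> relators"
  then show "abs_calg (fps_push f (p * r * q)) = 0"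
    using assms
    by (simp add: pres_hom_def fps_push_mult zero_calg.abs_eq calg.abs_eq_iff relator_in_closure)
qed

lemma push_push: "push f (push g p) = push (\<lambda>w. f (g w)) p"
  by (induction p rule: poly_additive_induct) (simp_all add: push_single push_add)

lemma fps_push_push: "fps_push f (fps_push g F) = fps_push (\<lambda>w. f (g w)) F"
  by (simp add: fps_eq_iff fps_push_def push_push)

lemma pres_hom_inl: "pres_hom (\<lambda>v. (v, 0))"
  and pres_hom_inr: "pres_hom (\<lambda>w. (0, w))"
  and pres_hom_flip: "pres_hom (\<lambda>(v, w). (w, v))"
  and pres_hom_assoc: "pres_hom (\<lambda>((u, v), w). (u, v, w))"
  and pres_hom_12: "pres_hom (\<lambda>(u, v). (u, v, 0))"
  and pres_hom_13: "pres_hom (\<lambda>(u, v). (u, 0, v))"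
  and pres_hom_23: "pres_hom (\<lambda>(u, v). (0, u, v))"
  by (auto simp: pres_hom_def relators_prod_def fps_push_push zero_prod_def image_Un image_image)

lemma tens_abs: "abs_calg F \<otimes> abs_calg G
    = abs_calg (fps_push (\<lambda>v. (v, 0)) F * fps_push (\<lambda>w. (0, w)) G)"
  by (simp add: tens_def cmap_abs pres_hom_inl pres_hom_inr times_calg.abs_eq)

lemma fps_push_mon: "fps_push f (fps_const (single w c)) = fps_const (single (f w) c)"
  by (simp add: fps_eq_iff fps_push_def push_single push_0)

lemma mon_tens_mon: "mon v \<otimes> mon w = mon (v, w)"
  by (simp add: mon_def tens_abs fps_push_mon mult_single)

lemma clinear_iff: "clinear h \<longleftrightarrow> (\<forall>x y. h (x + y) = h x + h y) \<and> (\<forall>c x. h (scal c * x) = scal c * h x)"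
  by (auto simp: module_hom_iff module_cscale cscale_def)

lemma clinear_flin: "clinear h \<Longrightarrow> flin (\<lambda>F. h (abs_calg F))"
  by (simp add: flin_def clinear_iff flip: plus_calg.abs_eq times_calg.abs_eq scal.abs_eq)

lemma clinear_eqI:
  assumes "clinear h" "clinear h'" "\<And>w. h (mon w) = h' (mon w)"
  shows "h = h'"
proof
  fix x
  show "h x = h' x"
    using flin_eqI[OF clinear_flin[OF assms(1)] clinear_flin[OF assms(2)]] assms(3)
    by (cases x) (simp add: mon_def)
qed

theorem tlift:
  fixes B :: "'u::presentation calg \<Rightarrow> 'v::presentation calg \<Rightarrow> 'w::presentation calg"
  assumes "cbilinear B"
  shows "\<exists>!h. clinear h \<and> (\<forall>x y. h (x \<otimes> y) = B x y)"
    and "clinear (tlift B)" and "tlift B (x \<otimes> y) = B x y"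
proof -
  have B1: "flin (\<lambda>F. B (abs_calg F) y)" and B2: "flin (\<lambda>G. B x (abs_calg G))" for x y
    using assms by (auto simp: cbilinear_def intro: clinear_flin[of "\<lambda>x. B x y"] clinear_flin[of "B x"])
  have B0: "B 0 y = 0" "B x 0 = 0" for x y
    using flin_0[OF B1] flin_0[OF B2] by (simp_all add: zero_calg.abs_eq)
  obtain T where T: "flin T" "\<And>u v. T (fps_const (single (u, v) 1)) = B (mon u) (mon v)"
    using flin_exists[of "\<lambda>(u, v). B (mon u) (mon v)"] by auto
  have flinT: "flin (\<lambda>p. T (p * r * q))" "flin (\<lambda>q. T (p * r * q))" for p r q
    using T(1) by (auto simp: flin_def distrib_left distrib_right mult.assoc fscal_left_commute)
  have rel: "T (p * r * q) = 0" if r: "r \<in> relators" for p r q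
  proof (rule flin_zeroI[OF flinT(1)], rule flin_zeroI[OF flinT(2)])
    fix u v :: "'u \<times> 'v"
    obtain u1 u2 v1 v2 where uv: "u = (u1, u2)" "v = (v1, v2)" by fastforce
    let ?M = "\<lambda>w. fps_const (single w 1)"
    from r consider r0 where "r0 \<in> relators" "r = fps_push (\<lambda>v. (v, 0)) r0"
      | r0 where "r0 \<in> relators" "r = fps_push (\<lambda>w. (0, w)) r0"
      by (auto simp: relators_prod_def)
    then show "T (?M u * r * ?M v) = 0"
    proof cases
      case 1
      have "T (?M u * fps_push (\<lambda>v. (v, 0)) r0 * ?M v)
          = B (abs_calg (?M u1 * r0 * ?M v1)) (mon (u2 + v2))"
      proof (rule flin_eqI[where F = r0])
        show "flin (\<lambda>F. T (?M u * fps_push (\<lambda>v. (v, 0)) F * ?M v))"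
          using T(1) by (auto simp: flin_def fps_push_add fps_push_mult fps_push_fscal
              zero_prod_def distrib_left distrib_right mult.assoc fscal_left_commute)
        show "flin (\<lambda>F. B (abs_calg (?M u1 * F * ?M v1)) (mon (u2 + v2)))"
          using B1[of "mon (u2 + v2)"] by (auto simp: flin_def distrib_left distrib_right mult.assoc
              fscal_left_commute)
      qed (simp add: uv fps_push_mon mult_single T(2) mon_def)
      also have "abs_calg (?M u1 * r0 * ?M v1) = 0"
        using 1(1) by (simp add: zero_calg.abs_eq calg.abs_eq_iff relator_in_closure)
      finally show ?thesis using 1(2) by (simp add: B0)
    next
      case 2
      have "T (?M u * fps_push (\<lambda>w. (0, w)) r0 * ?M v)
          = B (mon (u1 + v1)) (abs_calg (?M u2 * r0 * ?M v2))"
      proof (rule flin_eqI[where F = r0])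
        show "flin (\<lambda>F. T (?M u * fps_push (\<lambda>w. (0, w)) F * ?M v))"
          using T(1) by (auto simp: flin_def fps_push_add fps_push_mult fps_push_fscal
              zero_prod_def distrib_left distrib_right mult.assoc fscal_left_commute)
        show "flin (\<lambda>F. B (mon (u1 + v1)) (abs_calg (?M u2 * F * ?M v2)))"
          using B2[of "mon (u1 + v1)"] by (auto simp: flin_def distrib_left distrib_right mult.assoc
              fscal_left_commute)
      qed (simp add: uv fps_push_mon mult_single T(2) mon_def)
      also have "abs_calg (?M u2 * r0 * ?M v2) = 0"
        using 2(1) by (simp add: zero_calg.abs_eq calg.abs_eq_iff relator_in_closure)
      finally show ?thesis using 2(2) by (simp add: B0)
    qed
  qed
  define h where "h x = T (rep_calg x)" for x
  have h_abs: "h (abs_calg F) = T F" for F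
    unfolding h_def by (rule flin_descends[OF T(1) rel])
  have h: "clinear h"
    unfolding clinear_iff
  proof (intro conjI allI)
    fix x y c
    show "h (x + y) = h x + h y"
      by (cases x; cases y) (simp add: plus_calg.abs_eq h_abs flin_add[OF T(1)])
    show "h (scal c * x) = scal c * h x"
      by (cases x) (simp add: scal_abs h_abs flin_scal[OF T(1)])
  qed
  have tens1: "flin (\<lambda>F. h (abs_calg F \<otimes> y))" and tens2: "flin (\<lambda>G. h (x \<otimes> abs_calg G))" for x y
    using T(1)
    by (cases y; cases x; auto simp: tens_abs h_abs flin_def fps_push_add fps_push_mult fps_push_fscal
          zero_prod_def distrib_left distrib_right mult.assoc fscal_left_commute)+
  have h_mon: "h (mon (u, v)) = B (mon u) (mon v)" for u v
    by (simp add: mon_def[of "(u, v)"] h_abs T(2))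
  have hB: "h (x \<otimes> y) = B x y" for x y
  proof (cases x; cases y)
    fix F G assume xy: "x = abs_calg F" "y = abs_calg G"
    have 1: "h (mon u \<otimes> abs_calg G) = B (mon u) (abs_calg G)" for u
      by (rule flin_eqI[OF tens2 B2]) (simp only: h_mon mon_tens_mon flip: mon_def)
    have "h (abs_calg F \<otimes> abs_calg G) = B (abs_calg F) (abs_calg G)"
      by (rule flin_eqI[OF tens1 B1]) (rule 1[unfolded mon_def])
    then show ?thesis by (simp add: xy)
  qed
  have uniq: "h' = h" if "clinear h'" "\<forall>x y. h' (x \<otimes> y) = B x y" for h'
    by (rule clinear_eqI[OF that(1) h])
       (use that(2) hB in \<open>metis mon_tens_mon surj_pair\<close>)
  show ex1: "\<exists>!h. clinear h \<and> (\<forall>x y. h (x \<otimes> y) = B x y)"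
    using h hB uniq by blast
  from theI'[OF this] show "clinear (tlift B)" and "tlift B (x \<otimes> y) = B x y"
    by (simp_all add: tlift_def)
qed


section \<open>Hopf algebras and universal R-matrices\<close>

definition alg_hom :: "('v::presentation calg \<Rightarrow> 'w::presentation calg) \<Rightarrow> bool" where
  "alg_hom f \<longleftrightarrow> clinear f \<and> f 1 = 1 \<and> (\<forall>x y. f (x * y) = f x * f y)"

text \<open>
  In the counit and antipode axioms, \<open>tlift (\<lambda>x y. \<epsilon> x *\<^sub>R\<^sub>a y)\<close> is \<open>\<epsilon> \<otimes> id\<close> followed by the identification
  of \<open>\<real>[[a\<^sub>2]] \<otimes> U\<close> with \<open>U\<close>, and \<open>tlift (\<lambda>x y. S x * y)\<close> is \<open>S \<otimes> id\<close> followed by multiplication.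
\<close>

definition hopf_algebra ::
  "('w::presentation calg \<Rightarrow> ('w \<times> 'w) calg) \<Rightarrow> ('w calg \<Rightarrow> real fps) \<Rightarrow> ('w calg \<Rightarrow> 'w calg) \<Rightarrow> bool" where
  "hopf_algebra \<Delta> \<epsilon> S \<longleftrightarrow>
     alg_hom \<Delta> \<and>
     (\<forall>x. assoc (tmap \<Delta> id (\<Delta> x)) = tmap id \<Delta> (\<Delta> x)) \<and>
     module_hom cscale (*) \<epsilon> \<and> \<epsilon> 1 = 1 \<and> (\<forall>x y. \<epsilon> (x * y) = \<epsilon> x * \<epsilon> y) \<and>
     (\<forall>z. tlift (\<lambda>x y. \<epsilon> x *\<^sub>R\<^sub>a y) (\<Delta> z) = z \<and> tlift (\<lambda>x y. \<epsilon> y *\<^sub>R\<^sub>a x) (\<Delta> z) = z) \<and>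
     clinear S \<and>
     (\<forall>z. tlift (\<lambda>x y. S x * y) (\<Delta> z) = \<epsilon> z *\<^sub>R\<^sub>a 1 \<and> tlift (\<lambda>x y. x * S y) (\<Delta> z) = \<epsilon> z *\<^sub>R\<^sub>a 1)"

definition cinvertible :: "'w::presentation calg \<Rightarrow> bool" where
  "cinvertible x \<longleftrightarrow> (\<exists>y. x * y = 1 \<and> y * x = 1)"

definition cinv :: "'w::presentation calg \<Rightarrow> 'w calg" where
  "cinv x = (THE y. x * y = 1 \<and> y * x = 1)"

definition universal_R_matrix ::
  "('w::presentation calg \<Rightarrow> ('w \<times> 'w) calg) \<Rightarrow> ('w \<times> 'w) calg \<Rightarrow> bool" where
  "universal_R_matrix \<Delta> R \<longleftrightarrow>
     cinvertible R \<and>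
     (\<forall>X. R * \<Delta> X * cinv R = flip (\<Delta> X)) \<and>
     assoc (tmap \<Delta> id R) = leg13 R * leg23 R \<and>
     tmap id \<Delta> R = leg13 R * leg12 R"

definition triangular_universal_R_matrix ::
  "('w::presentation calg \<Rightarrow> ('w \<times> 'w) calg) \<Rightarrow> ('w \<times> 'w) calg \<Rightarrow> bool" where
  "triangular_universal_R_matrix \<Delta> R \<longleftrightarrow> universal_R_matrix \<Delta> R \<and> flip R = cinv R"

definition quantum_yang_baxter :: "('w::presentation \<times> 'w) calg \<Rightarrow> bool" where
  "quantum_yang_baxter R \<longleftrightarrow> leg12 R * leg13 R * leg23 R = leg23 R * leg13 R * leg12 R"

definition wedge :: "'w::presentation calg \<Rightarrow> 'w calg \<Rightarrow> ('w \<times> 'w) calg" where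
  "wedge x y = x \<otimes> y - y \<otimes> x"

text \<open>The term of first order in \<open>a\<^sub>2\<close> is understood modulo \<open>a\<^sub>2\<^sup>2\<close>.\<close>

definition classical_r_matrix :: "('w::presentation \<times> 'w) calg \<Rightarrow> ('w \<times> 'w) calg \<Rightarrow> bool" where
  "classical_r_matrix R r \<longleftrightarrow> (\<exists>x. r = a\<^sub>2 * x) \<and> (\<exists>y. R = 1 + r + a\<^sub>2\<^sup>2 * y)"

section \<open>The quantum Schroedinger algebra\<close>

datatype schr_gen = gD | gH | gP | gK | gC | gM

datatype schr_word = Word "schr_gen list"

instantiation schr_word :: word_monoid
begin

definition "0 = Word []"

fun plus_schr_word where "Word u + Word v = Word (u @ v)"

instance
proof
  fix u v w :: schr_word
  show "u + v + w = u + (v + w)" by (cases u; cases v; cases w) simp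
  show "0 + u = u" "u + 0 = u" by (cases u; simp add: zero_schr_word_def)+
  show "u = 0 \<and> v = 0" if "u + v = 0"
    using that by (cases u; cases v) (simp add: zero_schr_word_def)
qed

end

type_synonym schr_free = "(schr_word \<Rightarrow>\<^sub>0 real) fps"

definition fgen :: "schr_gen \<Rightarrow> schr_free" where
  "fgen g = fps_const (single (Word [g]) 1)"

text \<open>\<open>fexp c g\<close> is $e^{c a_2 g}$; see \<open>aexp_gen\<close> below.\<close>

definition fexp :: "real \<Rightarrow> schr_gen \<Rightarrow> schr_free" where
  "fexp c g = Abs_fps (\<lambda>n. single (Word (replicate n g)) (c ^ n / fact n))"

definition lie :: "'r::ring \<Rightarrow> 'r \<Rightarrow> 'r" where "lie x y = x * y - y * x"

text \<open>
  The pairs \<open>(l, r)\<close> stand for the relations \<open>l = r\<close>.  Since \<open>fexp (-2) gH - 1\<close> has no constant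
  coefficient, \<open>fps_shift 1\<close> divides it by \<open>a\<^sub>2\<close>.
\<close>

definition schr_relations :: "(schr_free \<times> schr_free) set" where
  "schr_relations =
    (let D = fgen gD; H = fgen gH; P = fgen gP; K = fgen gK; C = fgen gC; M = fgen gM;
         a = fscal fps_X; half = fscal (fps_const (1/2)) in
     {(lie D P, - P),
      (lie D K, K),
      (lie K P, M),
      (lie D H, fps_shift 1 (fexp (-2) gH - 1)),
      (lie D C, 2 * C - a * D\<^sup>2),
      (lie H C, D),
      (lie K H, fexp (-2) gH * P),
      (lie K C, - (half * a * (K * D + D * K))),
      (lie P C, - K + half * a * (D * P + P * D)),
      (lie P H, 0)}
     \<union> {(lie M (fgen g), 0) | g. True})"

definition aug :: "('w::word_monoid \<Rightarrow>\<^sub>0 real) fps \<Rightarrow> real fps" where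
  "aug F = Abs_fps (\<lambda>n. lookup (F $ n) 0)"

lemma aug_simps [simp]:
  "aug (F + G) = aug F + aug G" "aug (F - G) = aug F - aug G" "aug (- F) = - aug F"
  "aug (F * G) = aug F * aug G" "aug 0 = 0" "aug 1 = 1" "aug (fps_shift k F) = fps_shift k (aug F)"
  by (simp_all add: aug_def fps_eq_iff lookup_add lookup_minus fps_mult_nth lookup_sum lookup_mult_0
      lookup_one when_def)

lemma aug_gen [simp]: "aug (fgen g) = 0"
  by (simp add: aug_def fgen_def fps_eq_iff lookup_single zero_schr_word_def when_def)

lemma aug_fexp [simp]: "aug (fexp c g) = 1"
  by (auto simp: aug_def fexp_def fps_eq_iff lookup_single zero_schr_word_def when_def)

instantiation schr_word :: presentation
begin

definition relators_schr_word :: "schr_free set" where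
  "relators_schr_word = (\<lambda>(l, r). l - r) ` schr_relations"

instance
proof
  fix r :: schr_free and n
  assume "r \<in> relators"
  then have "aug r = 0"
    by (auto simp: relators_schr_word_def schr_relations_def Let_def lie_def power2_eq_square)
  from arg_cong[OF this, of "\<lambda>F. F $ n"] show "lookup (r $ n) 0 = 0"
    by (simp add: aug_def)
qed

end

type_synonym schr = "schr_word calg"

definition gen :: "schr_gen \<Rightarrow> schr" where "gen g = abs_calg (fgen g)"

lemma aexp_gen: "aexp (scal (fps_const c) * gen g) = abs_calg (fexp c g)"
proof -
  define f where "f n = fps_const (single (Word (replicate n g)) (c ^ n / fact n))" for n
  have gen_power: "gen g ^ n = mon (Word (replicate n g))" for n
    by (induction n)
       (simp_all add: gen_def fgen_def mon_def times_calg.abs_eq one_calg.abs_eq mult_single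
         flip: zero_schr_word_def)
  have pow: "(scal (fps_const c) * gen g) ^ n = scal (fps_const (c ^ n)) * gen g ^ n" for n
    by (induction n)
       (simp_all add: mult.assoc scal_left_commute[of "gen g"] scal_mult flip: fps_const_mult)
  have abs_f: "abs_calg (f n) = scal (fps_const (c ^ n / fact n)) * gen g ^ n" for n
    by (simp add: gen_power mon_def scal_abs f_def)
       (rule arg_cong[of _ _ abs_calg], simp add: fps_eq_iff mult_single)
  have coeff: "fps_const (1 / fact n) * fps_X ^ n * fps_const (c ^ n)
      = fps_X ^ n * fps_const (c ^ n / fact n)" for n
    by (simp add: fps_eq_iff)
  have "scal (fps_const (1 / fact n) * fps_X ^ n) * (scal (fps_const c) * gen g) ^ n
      = scal (fps_X ^ n) * abs_calg (f n)" for n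
    unfolding pow abs_f mult.assoc[symmetric] scal_mult[symmetric] coeff ..
  moreover have "Abs_fps (\<lambda>m. \<Sum>k\<le>m. f k $ (m - k)) = fexp c g"
  proof (rule fps_ext)
    fix m
    have "(\<Sum>k\<le>m. f k $ (m - k)) = (\<Sum>k\<le>m. if k = m then f m $ 0 else 0)"
      by (rule sum.cong) (auto simp: f_def)
    then show "Abs_fps (\<lambda>m. \<Sum>k\<le>m. f k $ (m - k)) $ m = fexp c g $ m"
      by (simp add: f_def fexp_def)
  qed
  ultimately show ?thesis
    using aexp_sums[of "scal (fps_const c) * gen g"] aadic_sums[of f] by (simp add: sums_unique2)
qed

end

theory Submission
  imports Defs
begin

text \<open>
  Let \<open>F = exp(a\<^sub>2 D \<otimes> H)\<close>, so that \<open>R = F\<^sub>2\<^sub>1\<inverse> F\<close>.  On every generator \<open>F \<Delta>(X) F\<inverse>\<close> is symmetric under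
  the flip, hence \<open>R\<close> intertwines \<open>\<Delta>\<close> with the opposite coproduct.  On three legs, \<open>F\<^sub>1\<^sub>2\<close> commutes with
  \<open>F\<^sub>1\<^sub>3\<close>, \<open>F\<^sub>1\<^sub>3\<close> commutes with \<open>F\<^sub>2\<^sub>3\<close>, and \<open>R\<^sub>2\<^sub>3\<close> commutes with \<open>F\<^sub>1\<^sub>2 F\<^sub>1\<^sub>3\<close>, because the latter is the exponential of
  \<open>a\<^sub>2 D \<otimes> \<Delta>(H)\<close> and \<open>R\<close> commutes with \<open>\<Delta>(H)\<close>.  The hexagon identities and the Yang--Baxter equation
  follow from these three relations and \<open>(\<Delta> \<otimes> id) F = F\<^sub>1\<^sub>2\<inverse> F\<^sub>1\<^sub>3 F\<^sub>2\<^sub>3 F\<^sub>1\<^sub>2\<close>.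
\<close>

section \<open>Evaluation of power series at the deformation parameter\<close>

text \<open>An element that can be divided by \<open>a\<^sub>2\<close> indefinitely lies in every
  \<open>a\<^sub>2\<close>-adic neighbourhood of zero, and the topology is separated. Below,
  \<open>Q\<close> is usually the family of all defects of an identity, and one step of unfolding
  shows that each defect is \<open>a\<^sub>2\<close> times another.\<close>

lemma calg_zero_coinduct [consumes 1, case_names divide]:
  assumes "Q x" and "\<And>x. Q x \<Longrightarrow> \<exists>y. Q y \<and> x = a\<^sub>2 * y"
  shows "x = (0 :: 'w::presentation calg)"
proof (rule calg_separated)
  have "\<exists>y. Q y \<and> x = scal (fps_X ^ n) * y" for n
  proof (induction n)
    case (Suc n)
    then obtain y where "Q y" "x = scal (fps_X ^ n) * y" by blast
    with assms(2)[of y] show ?case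
      by (auto simp: power_Suc2 scal_mult mult.assoc simp del: power_Suc)
  qed (use assms(1) in auto)
  then show "\<exists>y. x = scal (fps_X ^ n) * y" for n by blast
qed

text \<open>Substitution of \<open>a\<^sub>2\<close> for a formal variable, computed on
  representatives along antidiagonals; \<open>aeval_sums\<close> shows that it is the actual limit.
  Keeping the variable apart from \<open>a\<^sub>2\<close> permits division by \<open>fps_X\<close>
  and differentiation before evaluating.\<close>

definition aeval :: "'w::presentation calg fps \<Rightarrow> 'w calg" where
  "aeval F = abs_calg (Abs_fps (\<lambda>m. \<Sum>k\<le>m. rep_calg (F $ k) $ (m - k)))"

lemma abs_rep_calg [simp]: "abs_calg (rep_calg x) = x"
  by (rule Quotient3_abs_rep[OF Quotient3_calg])

lemma aeval_sums: "(\<lambda>n. scal (fps_X ^ n) * F $ n) sums aeval F"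
  using aadic_sums[of "\<lambda>n. rep_calg (F $ n)"] by (simp add: aeval_def)

lemma fscal_X: "fscal fps_X = fps_X"
  using fscal_X_power[of 1] by simp

text \<open>The Horner step, which drives all coinductions on \<open>aeval\<close>.\<close>

lemma aeval_unfold: "aeval F = F $ 0 + a\<^sub>2 * aeval (fps_shift 1 F)"
proof -
  let ?S = "\<lambda>F. Abs_fps (\<lambda>m. \<Sum>k\<le>m. rep_calg (F $ k) $ (m - k))"
  have "?S F = rep_calg (F $ 0) + fps_X * ?S (fps_shift 1 F)"
  proof (rule fps_ext)
    fix m
    show "?S F $ m = (rep_calg (F $ 0) + fps_X * ?S (fps_shift 1 F)) $ m"
      by (cases m) (simp_all add: sum.atMost_Suc_shift del: sum.atMost_Suc)
  qed
  then show ?thesis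
    by (simp add: aeval_def scal_abs fscal_X flip: plus_calg.abs_eq)
qed

lemma fps_shift_X_mult: "fps_shift (Suc 0) (fps_X * F) = (F :: 'b::semiring_1 fps)"
  by (simp add: fps_eq_iff)

lemma aeval_X_mult: "aeval (fps_X * F) = a\<^sub>2 * aeval F"
  by (subst aeval_unfold) (simp add: fps_shift_X_mult)

lemma aeval_add: "aeval (F + G) = aeval F + aeval G"
proof -
  have "aeval (F + G) - (aeval F + aeval G) = 0"
  proof (rule calg_zero_coinduct[where Q = "\<lambda>x. \<exists>F G. x = aeval (F + G) - (aeval F + aeval G)"])
    fix x :: "'a calg"
    assume "\<exists>F G. x = aeval (F + G) - (aeval F + aeval G)"
    then obtain F G where "x = aeval (F + G) - (aeval F + aeval G)" by blast
    then have "x = a\<^sub>2 * (aeval (fps_shift 1 F + fps_shift 1 G)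
        - (aeval (fps_shift 1 F) + aeval (fps_shift 1 G)))"
      by (simp add: aeval_unfold[of F] aeval_unfold[of G] aeval_unfold[of "F + G"]
          fps_shift_add algebra_simps)
    then show "\<exists>y. (\<exists>F G. y = aeval (F + G) - (aeval F + aeval G)) \<and> x = a\<^sub>2 * y" by blast
  qed blast
  then show ?thesis by simp
qed

lemma aeval_const [simp]: "aeval (fps_const c) = c"
proof -
  have "aeval (0 :: 'a calg fps) = 0" using aeval_add[of 0 0] by simp
  moreover have "fps_shift (Suc 0) (fps_const c) = 0" by (simp add: fps_eq_iff)
  ultimately show ?thesis by (subst aeval_unfold) simp
qed

lemma aeval_0 [simp]: "aeval 0 = 0" and aeval_1 [simp]: "aeval 1 = 1"
  using aeval_const[of 0] aeval_const[of 1] by simp_all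

lemma aeval_uminus: "aeval (- F) = - aeval F"
  using aeval_add[of F "- F"] by (simp add: eq_neg_iff_add_eq_0 add.commute)

lemma aeval_diff: "aeval (F - G) = aeval F - aeval G"
  using aeval_add[of F "- G"] by (simp add: aeval_uminus)

lemma aeval_X [simp]: "aeval fps_X = a\<^sub>2"
  using aeval_X_mult[of 1] by simp

lemma fps_head_tail: "F = fps_const (F $ 0) + fps_X * fps_shift 1 (F :: 'b::ring_1 fps)"
  using fps_split_at[of F 1] by simp

lemma fps_shift_const_mult:
  "fps_shift n (fps_const c * F) = fps_const c * fps_shift n (F :: 'b::ring_1 fps)"
  by (simp add: fps_eq_iff)

lemma fps_shift_mult_const:
  "fps_shift n (F * fps_const c) = fps_shift n F * fps_const (c :: 'b::ring_1)"
  by (simp add: fps_eq_iff)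

lemma aeval_const_mult: "aeval (fps_const c * F) = c * aeval F"
proof -
  have "aeval (fps_const c * F) - c * aeval F = 0"
  proof (rule calg_zero_coinduct[where Q = "\<lambda>x. \<exists>F. x = aeval (fps_const c * F) - c * aeval F"])
    fix x :: "'a calg"
    assume "\<exists>F. x = aeval (fps_const c * F) - c * aeval F"
    then obtain F where "x = aeval (fps_const c * F) - c * aeval F" by blast
    then have "x = a\<^sub>2 * (aeval (fps_const c * fps_shift 1 F) - c * aeval (fps_shift 1 F))"
      by (simp add: aeval_unfold[of F] aeval_unfold[of "fps_const c * F"]
          fps_shift_const_mult algebra_simps scal_left_commute)
    then show "\<exists>y. (\<exists>F. y = aeval (fps_const c * F) - c * aeval F) \<and> x = a\<^sub>2 * y" by blast
  qed blast
  then show ?thesis by simp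
qed

text \<open>Splitting off the head of \<open>F\<close> turns the defect for \<open>F\<close> and
  \<open>G\<close> into \<open>a\<^sub>2\<close> times the defect for \<open>fps_shift 1 F\<close>
  and \<open>G\<close>; the heads agree by \<open>aeval_const_mult\<close>.\<close>

lemma aeval_mult: "aeval (F * G) = aeval F * aeval G"
proof -
  have "aeval (F * G) - aeval F * aeval G = 0"
  proof (rule calg_zero_coinduct[where Q = "\<lambda>x. \<exists>F. x = aeval (F * G) - aeval F * aeval G"])
    fix x :: "'a calg"
    assume "\<exists>F. x = aeval (F * G) - aeval F * aeval G"
    then obtain F where x: "x = aeval (F * G) - aeval F * aeval G" by blast
    have "F * G = fps_const (F $ 0) * G + fps_X * (fps_shift 1 F * G)"
      by (subst fps_head_tail[of F]) (simp add: distrib_right mult.assoc)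
    then have "aeval (F * G) = F $ 0 * aeval G + a\<^sub>2 * aeval (fps_shift 1 F * G)"
      by (simp only: aeval_add aeval_const_mult aeval_X_mult)
    with x have "x = a\<^sub>2 * (aeval (fps_shift 1 F * G) - aeval (fps_shift 1 F) * aeval G)"
      by (simp add: aeval_unfold[of F] algebra_simps)
    then show "\<exists>y. (\<exists>F. y = aeval (F * G) - aeval F * aeval G) \<and> x = a\<^sub>2 * y" by blast
  qed blast
  then show ?thesis by simp
qed

section \<open>Algebra homomorphisms\<close>

lemma alg_homD:
  assumes "alg_hom f"
  shows alg_hom_add: "f (x + y) = f x + f y" and alg_hom_mult: "f (x * y) = f x * f y"
    and alg_hom_1: "f 1 = 1" and alg_hom_scal_mult: "f (scal c * x) = scal c * f x"
  using assms by (auto simp: alg_hom_def clinear_iff)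

lemma alg_homI:
  assumes "\<And>x y. f (x + y) = f x + f y" "\<And>c x. f (scal c * x) = scal c * f x"
    "f 1 = 1" "\<And>x y. f (x * y) = f x * f y"
  shows "alg_hom f"
  using assms by (auto simp: alg_hom_def clinear_iff)

lemma alg_hom_scal: "alg_hom f \<Longrightarrow> f (scal c) = scal c"
  using alg_hom_scal_mult[of f c 1] by (simp add: alg_hom_1)

lemma alg_hom_0: "alg_hom f \<Longrightarrow> f 0 = 0"
  using alg_hom_scal_mult[of f 0 0] by simp

lemma alg_hom_uminus: "alg_hom f \<Longrightarrow> f (- x) = - f x"
  using alg_hom_add[of f x "- x"] by (simp add: alg_hom_0 eq_neg_iff_add_eq_0 add.commute)

lemma alg_hom_diff: "alg_hom f \<Longrightarrow> f (x - y) = f x - f y"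
  using alg_hom_add[of f x "- y"] by (simp add: alg_hom_uminus)

lemma alg_hom_of_nat: "alg_hom f \<Longrightarrow> f (of_nat n) = of_nat n"
  by (induction n) (simp_all add: alg_hom_0 alg_hom_1 alg_hom_add)

lemma alg_hom_numeral: "alg_hom f \<Longrightarrow> f (numeral n) = numeral n"
  using alg_hom_of_nat[of f "numeral n"] by simp

lemma alg_hom_power: "alg_hom f \<Longrightarrow> f (x ^ n) = f x ^ n"
  by (induction n) (simp_all add: alg_hom_1 alg_hom_mult)

lemmas alg_hom_simps = alg_hom_add alg_hom_mult alg_hom_1 alg_hom_scal alg_hom_0 alg_hom_uminus
  alg_hom_diff alg_hom_numeral alg_hom_power

lemma alg_hom_comp: "alg_hom f \<Longrightarrow> alg_hom g \<Longrightarrow> alg_hom (\<lambda>x. f (g x))"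
  by (rule alg_homI) (simp_all add: alg_hom_simps)

text \<open>A homomorphism respects multiplication by \<open>a\<^sub>2\<close>, so it passes through
  each Horner step and, by coinduction, through the limit.\<close>

lemma alg_hom_aeval:
  assumes f: "alg_hom f"
  shows "f (aeval F) = aeval (Abs_fps (\<lambda>n. f (F $ n)))"
proof -
  let ?M = "\<lambda>F. Abs_fps (\<lambda>n. f (F $ n))"
  have "f (aeval F) - aeval (?M F) = 0"
  proof (rule calg_zero_coinduct[where Q = "\<lambda>x. \<exists>F. x = f (aeval F) - aeval (?M F)"])
    fix x
    assume "\<exists>F. x = f (aeval F) - aeval (?M F)"
    then obtain F where "x = f (aeval F) - aeval (?M F)" by blast
    moreover have "fps_shift 1 (?M F) = ?M (fps_shift 1 F)" by (simp add: fps_eq_iff)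
    ultimately have "x = a\<^sub>2 * (f (aeval (fps_shift 1 F)) - aeval (?M (fps_shift 1 F)))"
      by (simp add: aeval_unfold[of F] aeval_unfold[of "?M F"] alg_hom_simps[OF f] algebra_simps)
    then show "\<exists>y. (\<exists>F. y = f (aeval F) - aeval (?M F)) \<and> x = a\<^sub>2 * y" by blast
  qed blast
  then show ?thesis by simp
qed

section \<open>Exponential series\<close>

definition expS :: "'w::presentation calg \<Rightarrow> 'w calg fps" where
  "expS x = Abs_fps (\<lambda>n. scal (fps_const (1 / fact n)) * x ^ n)"

lemma expS_nth_0 [simp]: "expS x $ 0 = 1"
  by (simp add: expS_def)

lemma scal_of_nat: "scal (of_nat n) = of_nat n"
  by (induction n) (simp_all add: scal_add)

lemma scal_const_numeral: "scal (fps_const (numeral n)) = numeral n"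
  using scal_of_nat[of "numeral n"] by (simp add: numeral_fps_const)

text \<open>Positive integers are units, their inverses being real scalars.\<close>

lemma of_nat_cancel: "of_nat (Suc n) * x = of_nat (Suc n) * y \<Longrightarrow> x = (y :: 'w::presentation calg)"
proof -
  assume *: "of_nat (Suc n) * x = of_nat (Suc n) * y"
  have "scal (fps_const (1 / of_nat (Suc n))) * of_nat (Suc n) = (1 :: 'w calg)"
    unfolding scal_of_nat[symmetric] scal_mult[symmetric] fps_of_nat[symmetric] fps_const_mult
    by simp
  with arg_cong[OF *, of "\<lambda>x. scal (fps_const (1 / of_nat (Suc n))) * x"] show "x = y"
    by (metis mult.assoc mult_1)
qed

text \<open>The equation is the recurrence \<open>(n + 1) * A $ (n + 1) = z * A $ n\<close>. It
  replaces binomial expansions: exponential identities follow once both sides solve the same linear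
  equation.\<close>

lemma fps_ode_unique:
  fixes A B :: "'w::presentation calg fps"
  assumes "fps_deriv A = fps_const z * A" "fps_deriv B = fps_const z * B" "A $ 0 = B $ 0"
  shows "A = B"
proof (rule fps_ext)
  fix n
  show "A $ n = B $ n"
  proof (induction n)
    case (Suc n)
    have "of_nat (Suc n) * A $ Suc n = of_nat (Suc n) * B $ Suc n"
      using arg_cong[OF assms(1), of "\<lambda>F. F $ n"] arg_cong[OF assms(2), of "\<lambda>F. F $ n"] Suc by simp
    then show ?case by (rule of_nat_cancel)
  qed (rule assms(3))
qed

lemma expS_deriv: "fps_deriv (expS x) = fps_const x * expS x"
proof (rule fps_ext)
  fix n
  have "of_nat (Suc n) * scal (fps_const (1 / fact (Suc n)))
      = (scal (fps_const (1 / fact n)) :: 'a calg)"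
    unfolding scal_of_nat[symmetric] scal_mult[symmetric] fps_of_nat[symmetric] fps_const_mult
    by (simp add: field_simps del: of_nat_Suc)
  then show "fps_deriv (expS x) $ n = (fps_const x * expS x) $ n"
    by (simp add: expS_def scal_left_commute del: of_nat_Suc flip: mult.assoc)
       (simp add: mult.assoc scal_left_commute)
qed

lemma expS_commute: "x * y = y * x \<Longrightarrow> fps_const y * expS x = expS x * fps_const y"
proof -
  assume *: "x * y = y * x"
  have "y * x ^ n = x ^ n * y" for n
    by (rule power_commuting_commutes[symmetric]) (rule *)
  then show ?thesis
    by (simp add: fps_eq_iff expS_def scal_left_commute mult.assoc)
qed

text \<open>Both sides solve \<open>F' = (x + y) F\<close> with constant term 1; commutation serves
  to move \<open>y\<close> past \<open>expS x\<close>.\<close>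

lemma expS_add:
  assumes "x * y = y * x" shows "expS (x + y) = expS x * expS y"
proof (rule fps_ode_unique)
  have "fps_deriv (expS x * expS y) = expS x * fps_const y * expS y + fps_const x * expS x * expS y"
    by (simp add: expS_deriv mult.assoc)
  also have "\<dots> = fps_const (x + y) * (expS x * expS y)"
    by (simp add: algebra_simps flip: expS_commute[OF assms] fps_const_add)
  finally show "fps_deriv (expS x * expS y) = fps_const (x + y) * (expS x * expS y)" .
qed (simp_all add: expS_deriv)

lemma expS_0 [simp]: "expS 0 = 1"
  by (rule fps_ode_unique[of _ 0]) (simp_all add: expS_deriv)

lemma expS_minus: "expS (- x) * expS x = 1" "expS x * expS (- x) = 1"
  by (simp_all flip: expS_add)

lemma aexp_eq_aeval: "aexp x = aeval (expS x)"
proof -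
  have "scal (fps_const (1 / fact n) * fps_X ^ n) * x ^ n = scal (fps_X ^ n) * expS x $ n" for n
    by (subst mult.commute) (simp add: expS_def scal_mult mult.assoc)
  then show ?thesis
    using aexp_sums[of x] aeval_sums[of "expS x"] by (simp add: sums_unique2)
qed

lemma aexp_add: "x * y = y * x \<Longrightarrow> aexp (x + y) = aexp x * aexp y"
  by (simp add: aexp_eq_aeval expS_add aeval_mult)

lemma aexp_minus [simp]: "aexp (- x) * aexp x = 1" "aexp x * aexp (- x) = 1"
  by (simp_all add: aexp_eq_aeval expS_minus flip: aeval_mult)

lemma alg_hom_aexp: "alg_hom f \<Longrightarrow> f (aexp x) = aexp (f x)"
  by (simp add: aexp_eq_aeval alg_hom_aeval expS_def alg_hom_simps alg_hom_scal_mult)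

text \<open>By induction \<open>x ^ n * y = y * x' ^ n\<close>. The case \<open>x' = x\<close> is
  plain commutation; the case where \<open>x'\<close> is a shift of \<open>x\<close> describes the
  action of an exponential on an eigenvector.\<close>

lemma expS_mult_eigen:
  assumes "x * y = y * x'" shows "expS x * fps_const y = fps_const y * expS x'"
proof -
  have "x ^ n * y = y * x' ^ n" for n
    by (induction n) (simp_all add: assms mult.assoc, simp add: assms flip: mult.assoc)
  then show ?thesis by (simp add: fps_eq_iff expS_def scal_left_commute mult.assoc)
qed

lemma aexp_mult_eigen: "x * y = y * x' \<Longrightarrow> aexp x * y = y * aexp x'"
  using arg_cong[OF expS_mult_eigen, of x y x' aeval] by (simp add: aexp_eq_aeval aeval_mult)

lemma aexp_commute: "x * y = y * x \<Longrightarrow> aexp x * y = y * aexp x"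
  by (rule aexp_mult_eigen)

lemma aexp_commute2: "x * y = y * x \<Longrightarrow> aexp x * aexp y = aexp y * aexp x"
  by (intro aexp_commute aexp_commute[symmetric]) simp

text \<open>The adjoint action of an exponential, when it stops after two commutators.\<close>

lemma expS_mult_nilpotent:
  assumes "x * y = y * x + w" "x * w = w * x + v + v" "x * v = v * x"
  shows "expS x * fps_const y
    = (fps_const y + fps_X * fps_const w + fps_X * (fps_X * fps_const v)) * expS x"
    (is "_ = ?B * _")
proof (rule fps_ode_unique)
  let ?c = fps_const
  have X: "?c z * (fps_X * F) = fps_X * (?c z * F)" for z and F :: "'a calg fps"
    by (metis fps_mult_fps_X_commute mult.assoc)
  show "fps_deriv (expS x * ?c y) = ?c x * (expS x * ?c y)"
    by (simp add: expS_deriv mult.assoc)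
  \<comment> \<open>Here \<open>v\<close> is half of the double commutator, so \<open>?B\<close> is
    \<open>exp(X ad x) y\<close>, and the hypotheses say that its derivative is its commutator with
    \<open>x\<close>.\<close>
  have dB: "fps_deriv ?B = ?c w + fps_X * ?c (v + v)"
    by (simp add: distrib_left flip: fps_const_add)
  have "?c x * ?B = ?c (x * y) + fps_X * ?c (x * w) + fps_X * (fps_X * ?c (x * v))"
    by (simp add: distrib_left X)
  also have "\<dots> = fps_deriv ?B + ?B * ?c x"
    unfolding assms dB by (simp add: distrib_left distrib_right mult.assoc algebra_simps
        flip: fps_const_add)
  finally have "?c x * ?B = fps_deriv ?B + ?B * ?c x" .
  moreover have "p * (q * e) = q * (p * e) + r * e" if "p * q = r + q * p"
    for p q r e :: "'a calg fps"
    using that by (simp add: distrib_right add.commute flip: mult.assoc)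
  ultimately have "?c x * (?B * expS x) = ?B * (?c x * expS x) + fps_deriv ?B * expS x"
    by blast
  then show "fps_deriv (?B * expS x) = ?c x * (?B * expS x)"
    by (simp only: fps_deriv_mult expS_deriv)
qed simp

lemma aexp_mult_nilpotent:
  assumes "x * y = y * x + w" "x * w = w * x + v + v" "x * v = v * x"
  shows "aexp x * y = (y + a\<^sub>2 * w + a\<^sub>2 * (a\<^sub>2 * v)) * aexp x"
  using arg_cong[OF expS_mult_nilpotent[OF assms], of aeval]
  by (simp add: aexp_eq_aeval aeval_mult aeval_add aeval_X_mult)

text \<open>\<open>expm1 z\<close> is $(e^{a_2 z} - 1) / a_2$; as the algebras are not known to be torsion-free, the
  division has to happen at the level of series.\<close>

definition expm1 :: "'w::presentation calg \<Rightarrow> 'w calg" where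
  "expm1 z = aeval (fps_shift 1 (expS z))"

lemma aexp_eq_expm1: "aexp z = 1 + a\<^sub>2 * expm1 z"
  by (simp add: aexp_eq_aeval expm1_def aeval_unfold[of "expS z"])

text \<open>\<open>fps_shift 1\<close> is the difference quotient \<open>(F - F $ 0) / X\<close>,
  which obeys a twisted Leibniz rule.\<close>

lemma fps_shift_1_mult:
  "fps_shift 1 (F * G) = fps_shift 1 F * G + fps_const (F $ 0) * fps_shift 1 (G :: 'b::ring_1 fps)"
proof -
  have "F * G = fps_const (F $ 0) * G + fps_X * (fps_shift 1 F * G)"
    by (subst fps_head_tail[of F]) (simp add: distrib_right mult.assoc)
  then show ?thesis by (simp add: fps_eq_iff)
qed

text \<open>This is \<open>exp(x + y) - 1 = (exp x - 1) exp y + (exp y - 1)\<close>, divided by the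
  variable before evaluation.\<close>

lemma expm1_add: "x * y = y * x \<Longrightarrow> expm1 (x + y) = expm1 x * aexp y + expm1 y"
  unfolding expm1_def aexp_eq_aeval expS_add
  by (subst fps_shift_1_mult) (simp add: aeval_add aeval_mult)

lemma expm1_minus: "expm1 (- z) * aexp z = - expm1 z"
proof -
  have "expm1 (- z + z) = 0"
    by (simp add: expm1_def fps_eq_iff flip: aeval_0) (rule arg_cong[of _ _ aeval], simp add: fps_eq_iff)
  then show ?thesis
    using expm1_add[of "- z" z] by (simp add: eq_neg_iff_add_eq_0)
qed

lemma alg_hom_expm1: "alg_hom f \<Longrightarrow> f (expm1 x) = expm1 (f x)"
  unfolding expm1_def alg_hom_aeval
  by (rule arg_cong[of _ _ aeval]) (simp add: fps_eq_iff expS_def alg_hom_simps alg_hom_scal_mult)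

lemma expm1_mult_eigen:
  assumes "x * y = y * x'" shows "expm1 x * y = y * expm1 x'"
proof -
  from arg_cong[OF expS_mult_eigen[OF assms], of "\<lambda>F. aeval (fps_shift 1 F)"] show ?thesis
    by (simp add: expm1_def fps_shift_mult_const fps_shift_const_mult aeval_mult)
qed

text \<open>The case \<open>v = 0\<close> of the nilpotent rule gives
  \<open>[d, expS z] = X w expS z\<close>; the shift removes the factor \<open>X\<close>, and
  evaluation comes last.\<close>

lemma expm1_commutator:
  assumes "d * z = z * d + w" "z * w = w * z"
  shows "d * expm1 z = expm1 z * d + w * aexp z"
proof -
  have "expS z * fps_const d = (fps_const d + fps_X * fps_const (- w) + fps_X * (fps_X * fps_const 0)) * expS z"
    by (rule expS_mult_nilpotent) (simp_all add: assms)
  then have "fps_const d * expS z = expS z * fps_const d + fps_X * (fps_const w * expS z)"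
    by (simp add: left_diff_distrib mult.assoc flip: fps_const_neg)
  from arg_cong[OF this, of "\<lambda>F. aeval (fps_shift 1 F)"] show ?thesis
    by (simp add: expm1_def aexp_eq_aeval fps_shift_mult_const fps_shift_const_mult aeval_mult
        fps_shift_add aeval_add fps_shift_X_mult)
qed

lemma power_diff_divisible:
  assumes "x - y = scal c * z"
  shows "\<exists>w. x ^ n - y ^ n = scal c * (w :: 'w::presentation calg)"
proof (induction n)
  case (Suc n)
  then obtain w where w: "x ^ n - y ^ n = scal c * w" by blast
  have "x ^ Suc n - y ^ Suc n = x * (x ^ n - y ^ n) + (x - y) * y ^ n"
    by (simp add: algebra_simps)
  also have "\<dots> = scal c * (x * w + z * y ^ n)"
    by (simp add: w assms distrib_left scal_left_commute mult.assoc)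
  finally show ?case by blast
qed (auto intro: exI[of _ 0])

text \<open>\<open>expm1 x - expm1 y\<close> equals \<open>x - y\<close> up to a term divisible by one more power of \<open>a\<^sub>2\<close>.\<close>

lemma expm1_inject:
  assumes "expm1 x = expm1 y" shows "x = y"
proof -
  \<comment> \<open>Each round gains one power of \<open>a\<^sub>2\<close>; separatedness then
    forces the difference to vanish.\<close>
  have "\<exists>z. x - y = scal (fps_X ^ n) * z" for n
  proof (induction n)
    case (Suc n)
    then obtain z where z: "x - y = scal (fps_X ^ n) * z" by blast
    obtain w where w: "\<And>k. x ^ k - y ^ k = scal (fps_X ^ n) * w k"
      using power_diff_divisible[OF z] by metis
    define W where "W = Abs_fps (\<lambda>k. scal (fps_const (1 / fact k)) * w k)"
    have "expS x $ k - expS y $ k = scal (fps_X ^ n) * W $ k" for k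
      unfolding expS_def W_def fps_nth_Abs_fps right_diff_distrib[symmetric] w
      by (rule scal_left_commute)
    then have "expS x - expS y = fps_const (scal (fps_X ^ n)) * W"
      by (simp add: fps_eq_iff)
    then have "fps_shift 2 (expS x) - fps_shift 2 (expS y)
        = fps_const (scal (fps_X ^ n)) * fps_shift 2 W"
      by (simp add: fps_eq_iff)
    from arg_cong[OF this, of aeval]
    have "aeval (fps_shift 2 (expS x)) - aeval (fps_shift 2 (expS y))
        = scal (fps_X ^ n) * aeval (fps_shift 2 W)"
      by (simp add: aeval_diff aeval_mult)
    \<comment> \<open>The linear term is \<open>u\<close> itself, and every later term carries a
      further factor \<open>a\<^sub>2\<close>.\<close>
    moreover have "expm1 u = u + a\<^sub>2 * aeval (fps_shift 2 (expS u))" for u :: "'a calg"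
    proof -
      have "fps_shift 1 (expS u) $ 0 = u" by (simp add: expS_def)
      then show ?thesis
        unfolding expm1_def by (subst aeval_unfold) (simp add: numeral_2_eq_2 flip: fps_shift_fps_shift)
    qed
    ultimately have "x - y = a\<^sub>2 * - (scal (fps_X ^ n) * aeval (fps_shift 2 W))"
      using assms by (simp add: algebra_simps)
    then have "x - y = scal (fps_X ^ Suc n) * - aeval (fps_shift 2 W)"
      by (simp add: scal_mult mult.assoc)
    then show ?case by blast
  qed simp
  then show ?thesis using calg_separated[of "x - y"] by simp
qed

section \<open>Homomorphisms into tensor products\<close>

lemma alg_hom_cmap:
  assumes "pres_hom f" shows "alg_hom (cmap f)"
proof (rule alg_homI)
  have f: "f 0 = 0" "\<And>u v. f (u + v) = f u + f v"
    using assms by (auto simp: pres_hom_def)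
  note flin = flin_push[of f, OF f]
  show "cmap f (x + y) = cmap f x + cmap f y" for x y
    by (cases x; cases y) (simp add: cmap_abs[OF assms] flin_add[OF flin] plus_calg.abs_eq)
  show "cmap f (scal c * x) = scal c * cmap f x" for c x
    by (cases x) (simp add: cmap_abs[OF assms] flin_scal[OF flin] scal_abs)
  show "cmap f (x * y) = cmap f x * cmap f y" for x y
    by (cases x; cases y) (simp add: cmap_abs[OF assms] fps_push_mult f times_calg.abs_eq)
  show "cmap f 1 = 1"
    using fps_push_fscal[of f 1] f by (simp add: cmap_abs[OF assms] one_calg.abs_eq)
qed

lemma pres_hom_comp: "pres_hom f \<Longrightarrow> pres_hom g \<Longrightarrow> pres_hom (\<lambda>x. f (g x))"
  unfolding pres_hom_def fps_push_push[symmetric] by metis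

lemma cmap_cmap: "pres_hom f \<Longrightarrow> pres_hom g \<Longrightarrow> cmap f (cmap g x) = cmap (\<lambda>x. f (g x)) x"
  by (cases x) (simp add: cmap_abs pres_hom_comp fps_push_push)

lemma cmap_mon: "pres_hom f \<Longrightarrow> cmap f (mon w) = mon (f w)"
  by (simp add: mon_def cmap_abs fps_push_mon)

lemma mon_add: "mon (u + v) = mon u * mon v"
  by (simp add: mon_def times_calg.abs_eq mult_single)

lemma mon_0 [simp]: "mon 0 = 1"
  by (simp add: mon_def one_calg.abs_eq flip: fps_const_1_eq_1)

lemma clinearI:
  "(\<And>x y. h (x + y) = h x + h y) \<Longrightarrow> (\<And>c x. h (scal c * x) = scal c * h x) \<Longrightarrow> clinear h"
  by (simp add: clinear_iff)

lemma clinear_mult_left: "alg_hom f \<Longrightarrow> clinear (\<lambda>x. c * f x)"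
  and clinear_mult_right: "alg_hom f \<Longrightarrow> clinear (\<lambda>x. f x * c)"
  by (auto intro!: clinearI simp: alg_hom_simps alg_hom_scal_mult distrib_left distrib_right
      scal_left_commute mult.assoc)

text \<open>Linear maps are determined by their values on words, so it suffices to commute images of
  words, extending one argument at a time.\<close>

lemma cmap_commute:
  assumes "pres_hom f" "pres_hom g" "\<And>u v. f u + g v = g v + f u"
  shows "cmap f x * cmap g y = cmap g y * cmap f x"
proof -
  note hom = alg_hom_cmap[OF assms(1)] alg_hom_cmap[OF assms(2)]
  have 1: "cmap f (mon u) * cmap g y = cmap g y * cmap f (mon u)" for u
  proof (rule fun_cong[of _ _ y], rule clinear_eqI)
    show "cmap f (mon u) * cmap g (mon w) = cmap g (mon w) * cmap f (mon u)" for w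
      by (simp add: cmap_mon assms flip: mon_add)
  qed (rule clinear_mult_left[OF hom(2)] clinear_mult_right[OF hom(2)])+
  show ?thesis
    by (rule fun_cong[of _ _ x], rule clinear_eqI)
       (rule clinear_mult_left[OF hom(1)] clinear_mult_right[OF hom(1)] 1)+
qed

lemma alg_hom_id: "alg_hom id"
  by (rule alg_homI) auto

lemma alg_hom_inl: "alg_hom (cmap (\<lambda>v. (v, 0)))" and alg_hom_inr: "alg_hom (cmap (\<lambda>w. (0, w)))"
  by (intro alg_hom_cmap pres_hom_inl pres_hom_inr)+

lemma inl_inr_commute:
  "cmap (\<lambda>v. (v, 0)) x * cmap (\<lambda>w. (0, w)) y = cmap (\<lambda>w. (0, w)) y * cmap (\<lambda>v. (v, 0)) x"
  by (rule cmap_commute[OF pres_hom_inl pres_hom_inr]) simp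

lemma tens_mult_tens: "(x \<otimes> y) * (x' \<otimes> y') = (x * x') \<otimes> (y * y')"
  unfolding tens_def alg_hom_mult[OF alg_hom_inl] alg_hom_mult[OF alg_hom_inr]
proof -
  have "p * q * (r * s) = p * r * (q * s)" if "r * q = q * r" for p q r s :: "('a \<times> 'b) calg"
    using that by (metis mult.assoc)
  then show "cmap (\<lambda>v. (v, 0)) x * cmap (\<lambda>w. (0, w)) y * (cmap (\<lambda>v. (v, 0)) x' * cmap (\<lambda>w. (0, w)) y')
    = cmap (\<lambda>v. (v, 0)) x * cmap (\<lambda>v. (v, 0)) x' * (cmap (\<lambda>w. (0, w)) y * cmap (\<lambda>w. (0, w)) y')"
    using inl_inr_commute by blast
qed

lemma tens_1_1: "1 \<otimes> 1 = 1"
  by (simp add: tens_def alg_hom_1 alg_hom_inl alg_hom_inr)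

lemma cbilinear_tens:
  assumes "alg_hom f" "alg_hom g" shows "cbilinear (\<lambda>x y. f x \<otimes> g y)"
  unfolding cbilinear_def tens_def
  by (intro conjI allI clinear_mult_left[OF alg_hom_comp[OF alg_hom_inr assms(2)]]
      clinear_mult_right[OF alg_hom_comp[OF alg_hom_inl assms(1)]])

lemma
  assumes "alg_hom f" "alg_hom g"
  shows tmap_tens: "tmap f g (x \<otimes> y) = f x \<otimes> g y"
    and clinear_tmap: "clinear (tmap f g)"
  unfolding tmap_def using tlift(2,3)[OF cbilinear_tens[OF assms]] by auto

text \<open>The universal property supplies only a linear map. Multiplicativity holds on words by
  \<open>tens_mult_tens\<close> and extends linearly in each argument.\<close>

lemma alg_hom_tmap:
  assumes "alg_hom f" "alg_hom g" shows "alg_hom (tmap f g)"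
proof -
  let ?h = "tmap f g"
  note lin = clinear_tmap[OF assms] and tens = tmap_tens[OF assms]
  have add: "?h (x + y) = ?h x + ?h y" and scal: "?h (scal c * x) = scal c * ?h x" for x y c
    using lin by (auto simp: clinear_iff)
  have mon: "?h (mon u * mon v) = ?h (mon u) * ?h (mon v)" for u v
    by (cases u; cases v)
       (simp add: tens tens_mult_tens alg_hom_mult assms flip: mon_tens_mon)
  have 1: "?h (mon u * y) = ?h (mon u) * ?h y" for u y
    by (rule fun_cong[of _ _ y], rule clinear_eqI)
       (auto intro!: clinearI simp: distrib_left add scal scal_left_commute mon)
  have mult: "?h (x * y) = ?h x * ?h y" for x y
    by (rule fun_cong[of _ _ x], rule clinear_eqI)
       (auto intro!: clinearI simp: distrib_right add scal mult.assoc 1)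
  have "?h (1 \<otimes> 1) = 1 \<otimes> 1"
    by (simp only: tens alg_hom_1[OF assms(1)] alg_hom_1[OF assms(2)])
  then have "?h 1 = 1" by (simp only: tens_1_1)
  with add scal mult show ?thesis by (intro alg_homI)
qed

section \<open>The three legs of the triple tensor power\<close>

definition in1 :: "'w::presentation calg \<Rightarrow> ('w \<times> 'w \<times> 'w) calg" where "in1 = cmap (\<lambda>v. (v, 0, 0))"
definition in2 :: "'w::presentation calg \<Rightarrow> ('w \<times> 'w \<times> 'w) calg" where "in2 = cmap (\<lambda>v. (0, v, 0))"
definition in3 :: "'w::presentation calg \<Rightarrow> ('w \<times> 'w \<times> 'w) calg" where "in3 = cmap (\<lambda>v. (0, 0, v))"

lemma pres_hom_in:
  "pres_hom (\<lambda>v::'u::presentation. (v, 0::'v::presentation, 0::'w::presentation))"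
  "pres_hom (\<lambda>v::'v::presentation. (0::'u::presentation, v, 0::'w::presentation))"
  "pres_hom (\<lambda>v::'w::presentation. (0::'u::presentation, 0::'v::presentation, v))"
proof -
  have "pres_hom (\<lambda>v::'u. (v, 0::'v \<times> 'w))" by (rule pres_hom_inl)
  then show "pres_hom (\<lambda>v::'u. (v, 0::'v, 0::'w))" by (simp add: zero_prod_def)
qed (rule pres_hom_comp[OF pres_hom_inr pres_hom_inl] pres_hom_comp[OF pres_hom_inr pres_hom_inr])+

lemma alg_hom_in: "alg_hom in1" "alg_hom in2" "alg_hom in3"
  unfolding in1_def in2_def in3_def by (intro alg_hom_cmap pres_hom_in)+

lemma in_commute: "in1 x * in2 y = in2 y * in1 x" "in1 x * in3 y = in3 y * in1 x"
  "in2 x * in3 y = in3 y * in2 x"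
  unfolding in1_def in2_def in3_def by (rule cmap_commute; simp add: pres_hom_in)+

lemma alg_hom_leg: "alg_hom leg12" "alg_hom leg13" "alg_hom leg23" "alg_hom assoc" "alg_hom flip"
  unfolding leg12_def leg13_def leg23_def assoc_def flip_def
  by (intro alg_hom_cmap pres_hom_12 pres_hom_13 pres_hom_23 pres_hom_assoc pres_hom_flip)+

lemma leg_tens: "leg12 (x \<otimes> y) = in1 x * in2 y" "leg13 (x \<otimes> y) = in1 x * in3 y"
  "leg23 (x \<otimes> y) = in2 x * in3 y"
  unfolding tens_def alg_hom_mult[OF alg_hom_leg(1)] alg_hom_mult[OF alg_hom_leg(2)]
    alg_hom_mult[OF alg_hom_leg(3)]
  by (simp_all add: leg12_def leg13_def leg23_def in1_def in2_def in3_def cmap_cmap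
      pres_hom_12 pres_hom_13 pres_hom_23 pres_hom_inl pres_hom_inr)

text \<open>Together with \<open>tens_leg23\<close>, this brings both iterated coproducts into
  products of legs inside a single algebra, where the hexagon identities can be compared.\<close>

lemma assoc_tens: "assoc (t \<otimes> z) = leg12 t * in3 z"
  unfolding tens_def alg_hom_mult[OF alg_hom_leg(4)]
  by (simp add: assoc_def leg12_def in3_def cmap_cmap pres_hom_inl pres_hom_inr pres_hom_assoc)
     (simp add: zero_prod_def case_prod_unfold)

lemma tens_leg23: "x \<otimes> t = in1 x * leg23 t"
  by (simp add: tens_def in1_def leg23_def zero_prod_def case_prod_unfold)

lemma flip_tens: "flip (x \<otimes> y) = y \<otimes> x"
  unfolding tens_def alg_hom_mult[OF alg_hom_leg(5)]
  by (simp add: flip_def cmap_cmap pres_hom_inl pres_hom_inr pres_hom_flip inl_inr_commute)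

section \<open>Relations of the quantum Schroedinger algebra\<close>

lemma schr_relation: "(l, r) \<in> schr_relations \<Longrightarrow> abs_calg l = abs_calg r"
  using relator_in_closure[of "l - r" 1 1]
  by (force simp: calg.abs_eq_iff relators_schr_word_def)

lemma abs_calg_lie: "abs_calg (lie x y) = lie (abs_calg x) (abs_calg y)"
  by (simp add: lie_def minus_calg.abs_eq times_calg.abs_eq)

text \<open>A series over the free algebra may be projected coefficient by coefficient, so a shift
  of the free series can be matched with a shift of \<open>expS\<close>.\<close>

lemma abs_calg_eq_aeval: "abs_calg F = aeval (Abs_fps (\<lambda>n. abs_calg (fps_const (F $ n))))"
proof -
  have "Abs_fps (\<lambda>m. \<Sum>k\<le>m. fps_const (F $ k) $ (m - k)) = F"
  proof (rule fps_ext)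
    fix m
    have "(\<Sum>k\<le>m. fps_const (F $ k) $ (m - k)) = (\<Sum>k\<le>m. if k = m then F $ m else 0)"
      by (rule sum.cong) auto
    then show "Abs_fps (\<lambda>m. \<Sum>k\<le>m. fps_const (F $ k) $ (m - k)) $ m = F $ m" by simp
  qed
  then show ?thesis
    using aadic_sums[of "\<lambda>n. fps_const (F $ n)"]
      aeval_sums[of "Abs_fps (\<lambda>n. abs_calg (fps_const (F $ n)))"]
    by (simp add: sums_unique2)
qed

lemma abs_calg_single_replicate:
  "abs_calg (fps_const (single (Word (replicate n g)) c)) = scal (fps_const c) * gen g ^ n"
proof -
  have "gen g ^ n = mon (Word (replicate n g))"
    by (induction n)
       (simp_all add: gen_def fgen_def mon_def times_calg.abs_eq one_calg.abs_eq mult_single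
         flip: zero_schr_word_def)
  moreover have "fps_const (single (Word (replicate n g)) c)
      = fscal (fps_const c) * fps_const (single (Word (replicate n g)) 1)"
    by (simp add: fps_eq_iff mult_single)
  ultimately show ?thesis by (simp add: mon_def scal_abs)
qed

text \<open>Identifies the right side of the relation for \<open>[D, H]\<close>: the division by
  \<open>a\<^sub>2\<close> made there in the free algebra agrees with the one in
  \<open>expm1\<close>.\<close>

lemma abs_calg_expm1: "abs_calg (fps_shift 1 (fexp c g - 1)) = expm1 (scal (fps_const c) * gen g)"
proof -
  have pow: "(scal (fps_const c) * gen g) ^ n = scal (fps_const (c ^ n)) * gen g ^ n" for n
    by (induction n)
       (simp_all add: mult.assoc scal_left_commute[of "gen g"] scal_mult flip: fps_const_mult)
  have "abs_calg (fps_const (fps_shift 1 (fexp c g - 1) $ n))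
      = fps_shift 1 (expS (scal (fps_const c) * gen g)) $ n" for n
  proof -
    have "abs_calg (fps_const (fps_shift 1 (fexp c g - 1) $ n))
        = scal (fps_const (c ^ Suc n / fact (Suc n))) * gen g ^ Suc n"
      by (simp add: fexp_def flip: abs_calg_single_replicate del: replicate_Suc fact_Suc power_Suc)
    also have "\<dots> = scal (fps_const (1 / fact (Suc n))) * (scal (fps_const (c ^ Suc n)) * gen g ^ Suc n)"
      unfolding mult.assoc[symmetric] scal_mult[symmetric] fps_const_mult by simp
    finally show ?thesis
      by (simp add: expS_def pow del: fact_Suc power_Suc)
  qed
  then show ?thesis
    by (subst abs_calg_eq_aeval, unfold expm1_def)
       (rule arg_cong[of _ _ aeval], simp add: fps_eq_iff)
qed

lemma scal_const_minus_2: "scal (fps_const (- 2)) = - 2"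
proof -
  have "scal (fps_const (- 2)) + scal (fps_const 2) = (0 :: 'a calg)"
    by (simp flip: scal_add)
  then show ?thesis by (simp add: scal_const_numeral eq_neg_iff_add_eq_0)
qed

text \<open>The relations are oriented so that \<open>D\<close> or \<open>H\<close> moves to the
  right, as conjugation by an exponential of \<open>D \<otimes> H\<close> requires.\<close>

lemma gen_relations:
  defines "D \<equiv> gen gD" and "H \<equiv> gen gH" and "P \<equiv> gen gP"
    and "K \<equiv> gen gK" and "C \<equiv> gen gC" and "M \<equiv> gen gM"
  shows "D * P = P * D - P" "D * K = K * D + K"
    "D * H = H * D + expm1 (- 2 * H)"
    "D * C = C * D + 2 * C - a\<^sub>2 * (D * D)"
    "H * C = C * H + D" "H * K = K * H - aexp (- 2 * H) * P" "H * P = P * H"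
    "M * gen g = gen g * M"
proof -
  note rel = schr_relations_def Let_def
  note abs = abs_calg_lie lie_def minus_calg.abs_eq[symmetric] plus_calg.abs_eq[symmetric]
    times_calg.abs_eq[symmetric] uminus_calg.abs_eq[symmetric] zero_calg.abs_eq[symmetric]
    gen_def[symmetric]
  have eq: "\<And>x y z. x - y = z \<Longrightarrow> x = y + (z :: schr)" by (simp add: algebra_simps)
  have two: "abs_calg 2 = (2 :: schr)"
    using plus_calg.abs_eq[of 1 1] by (simp add: one_calg.abs_eq[symmetric])
  have fexp: "abs_calg (fexp (-2) gH) = aexp (- 2 * H)"
    using aexp_gen[of "-2" gH] by (simp add: scal_const_minus_2 H_def)
  have "abs_calg (lie (fgen gD) (fgen gP)) = abs_calg (- fgen gP)"
    by (rule schr_relation) (simp add: rel)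
  then show "D * P = P * D - P"
    by (simp add: abs D_def P_def algebra_simps)
  have "abs_calg (lie (fgen gD) (fgen gK)) = abs_calg (fgen gK)"
    by (rule schr_relation) (simp add: rel)
  then show "D * K = K * D + K"
    by (simp add: abs D_def K_def algebra_simps)
  have "abs_calg (lie (fgen gD) (fgen gH)) = abs_calg (fps_shift 1 (fexp (-2) gH - 1))"
    by (rule schr_relation) (simp add: rel)
  then show "D * H = H * D + expm1 (- 2 * H)"
    unfolding abs_calg_expm1 by (simp add: abs D_def H_def scal_const_minus_2 algebra_simps)
  have "abs_calg (lie (fgen gD) (fgen gC)) = abs_calg (2 * fgen gC - fscal fps_X * (fgen gD)\<^sup>2)"
    by (rule schr_relation) (simp add: rel)
  then show "D * C = C * D + 2 * C - a\<^sub>2 * (D * D)"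
    by (simp add: abs D_def C_def algebra_simps power2_eq_square two scal.abs_eq[symmetric])
  have "abs_calg (lie (fgen gH) (fgen gC)) = abs_calg (fgen gD)"
    by (rule schr_relation) (simp add: rel)
  then show "H * C = C * H + D"
    by (simp add: abs D_def H_def C_def algebra_simps)
  have "abs_calg (lie (fgen gK) (fgen gH)) = abs_calg (fexp (-2) gH * fgen gP)"
    by (rule schr_relation) (simp add: rel)
  then show "H * K = K * H - aexp (- 2 * H) * P"
    by (simp add: abs fexp P_def H_def K_def algebra_simps)
  have "abs_calg (lie (fgen gP) (fgen gH)) = abs_calg 0"
    by (rule schr_relation) (simp add: rel)
  then show "H * P = P * H"
    by (simp add: abs P_def H_def algebra_simps)
  have "abs_calg (lie (fgen gM) (fgen g)) = abs_calg 0"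
    by (rule schr_relation) (auto simp: rel)
  then show "M * gen g = gen g * M"
    by (simp add: abs M_def algebra_simps)
qed

section \<open>The twist\<close>

lemma scal_uminus: "scal (- c) = - scal c"
  using scal_add[of c "- c"] by (simp add: eq_neg_iff_add_eq_0 add.commute)

lemma scal_numeral: "scal (numeral n) = numeral n"
  using scal_of_nat[of "numeral n"] by simp

lemma aexp_linear_commute: "aexp (c * x) * x = x * aexp (c * x)" if "c * x = x * c"
  by (rule aexp_commute) (metis mult.assoc that)

lemma inverse_intertwine:
  fixes t :: "'r::ring_1"
  assumes "t * t' = 1" "t' * t = 1" "t * v = s * t"
  shows "t' * s = v * t'"
proof -
  have "t' * s = t' * (s * t) * t'" using assms(1) by (simp add: mult.assoc)
  also have "\<dots> = v * t'" by (metis assms(2,3) mult.assoc mult_1)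
  finally show ?thesis .
qed

lemma mult_commute_mult:
  fixes x :: "'r::semigroup_mult"
  assumes "x * z = z * x" "x * w = w * x" "y * z = z * y" "y * w = w * y"
  shows "x * y * (z * w) = z * w * (x * y)"
proof -
  have "x * y * (z * w) = x * z * (y * w)" by (simp add: assms(3) flip: mult.assoc) (simp add: assms(3) mult.assoc)
  also have "\<dots> = z * (x * w) * y" by (simp add: assms(1,4) mult.assoc)
  also have "\<dots> = z * w * (x * y)" by (simp add: assms(2) mult.assoc)
  finally show ?thesis .
qed

text \<open>Conjugation by \<open>t\<close> multiplies \<open>y\<close> by \<open>p\<close> and
  fixes \<open>q\<close>, the inverse of \<open>p\<close>. In this way the twist strips the
  group-like factor from a coproduct.\<close>

lemma eigen_cancel:
  fixes t :: "'r::ring_1"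
  assumes "t * y = y * p * t" "t * q = q * t" "p * q = 1"
  shows "t * (y * q) = y * t"
proof -
  have "t * (y * q) = y * p * (t * q)" using assms(1) by (simp flip: mult.assoc)
  also have "\<dots> = y * (p * q) * t" by (simp add: assms(2) mult.assoc)
  finally show ?thesis by (simp add: assms(3))
qed

text \<open>On the legs \<open>f\<close> and \<open>g\<close> this is
  \<open>F = exp(a\<^sub>2 D \<otimes> H)\<close>; exchanging the two arguments gives
  \<open>F\<close> on the flipped legs, as in \<open>Rmat\<close>.\<close>

definition twist :: "(schr \<Rightarrow> 'w::presentation calg) \<Rightarrow> (schr \<Rightarrow> 'w calg) \<Rightarrow> 'w calg" where
  "twist f g = aexp (f (gen gD) * g (gen gH))"

definition twist_inv :: "(schr \<Rightarrow> 'w::presentation calg) \<Rightarrow> (schr \<Rightarrow> 'w calg) \<Rightarrow> 'w calg" where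
  "twist_inv f g = aexp (- (f (gen gD) * g (gen gH)))"

definition Rmat :: "(schr \<Rightarrow> 'w::presentation calg) \<Rightarrow> (schr \<Rightarrow> 'w calg) \<Rightarrow> 'w calg" where
  "Rmat f g = twist_inv g f * twist f g"

lemma twist_inv [simp]: "twist f g * twist_inv f g = 1" "twist_inv f g * twist f g = 1"
  by (simp_all add: twist_def twist_inv_def)

lemma twist_inv_cancel [simp]:
  "twist f g * (twist_inv f g * x) = x" "twist_inv f g * (twist f g * x) = x"
  by (simp_all flip: mult.assoc)

text \<open>Abstract commuting legs make the flip a mere exchange of \<open>f\<close> and
  \<open>g\<close>, and allow the same computations for every pair of legs of the triple tensor
  power.\<close>

locale commuting_pair =
  fixes f g :: "schr \<Rightarrow> 'w::presentation calg"
  assumes hom: "alg_hom f" "alg_hom g" and comm: "g y * f x = f x * g y"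
begin

abbreviation (input) "D \<equiv> gen gD"
abbreviation (input) "H \<equiv> gen gH"
abbreviation (input) "P \<equiv> gen gP"
abbreviation (input) "K \<equiv> gen gK"
abbreviation (input) "C \<equiv> gen gC"
abbreviation (input) "M \<equiv> gen gM"

lemmas hom_simps = alg_hom_simps[OF hom(1)] alg_hom_simps[OF hom(2)]
  alg_hom_aexp[OF hom(1)] alg_hom_aexp[OF hom(2)]

lemma swap: "commuting_pair g f"
  by unfold_locales (simp_all add: hom comm)

lemma comm_left: "g y * (f x * z) = f x * (g y * z)"
  by (metis comm mult.assoc)

lemma fg_mult: "(f x * g y) * (f x' * g y') = f (x * x') * g (y * y')"
  by (simp add: hom_simps mult.assoc comm_left)

lemma fg_mult_f: "(f x * g y) * f x' = f (x * x') * g y"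
  and fg_mult_g: "(f x * g y) * g y' = f x * g (y * y')"
  and f_mult_fg: "f x' * (f x * g y) = f (x' * x) * g y"
  and g_mult_fg: "g y' * (f x * g y) = f x * g (y' * y)"
  by (simp_all add: hom_simps mult.assoc comm comm_left)

lemmas fg = fg_mult fg_mult_f fg_mult_g f_mult_fg g_mult_fg

text \<open>The commutator of \<open>D \<otimes> H\<close> with \<open>1 \<otimes> y\<close> is
  \<open>D \<otimes> w\<close>, which commutes with \<open>D \<otimes> H\<close>, so the adjoint
  series stops after one term.\<close>

lemma twist_mult_g:
  assumes "H * y = y * H + w" "H * w = w * H"
  shows "twist f g * g y = (g y + f D * g (a\<^sub>2 * w)) * twist f g"
proof -
  have "twist f g * g y = (g y + a\<^sub>2 * (f D * g w) + a\<^sub>2 * (a\<^sub>2 * 0)) * twist f g"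
    unfolding twist_def
    by (rule aexp_mult_nilpotent) (simp_all add: fg assms, simp add: hom_simps distrib_left)
  then show ?thesis by (simp add: alg_hom_scal_mult[OF hom(2)] scal_left_commute)
qed

lemma twist_commute:
  assumes "D * x = x * D" "H * y = y * H"
  shows "twist f g * (f x * g y) = f x * g y * twist f g"
  unfolding twist_def by (rule aexp_commute) (simp add: fg assms)

text \<open>Moving an eigenvector \<open>y\<close> of \<open>[D, _]\<close> across
  \<open>D \<otimes> H\<close> adds \<open>k\<close> times \<open>1 \<otimes> H\<close>, whose
  exponential splits off because it commutes with the rest.\<close>

lemma twist_mult_f:
  assumes "D * y = y * D + scal k * y"
  shows "twist f g * f y = f y * g (aexp (scal k * H)) * twist f g"
proof -
  let ?x = "f D * g H"
  have c: "?x * (scal k * g H) = scal k * g H * ?x"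
    by (simp add: scal_left_commute mult.assoc hom_simps comm comm_left)
  have "?x * f y = f y * (?x + scal k * g H)"
    unfolding fg_mult_f assms
    by (simp add: hom_simps distrib_left distrib_right mult.assoc scal_left_commute)
  then have "twist f g * f y = f y * aexp (scal k * g H + ?x)"
    unfolding twist_def by (subst add.commute) (rule aexp_mult_eigen)
  moreover have "aexp (scal k * g H + ?x) = aexp (scal k * g H) * aexp ?x"
    by (rule aexp_add) (rule c[symmetric])
  ultimately show ?thesis
    by (simp add: twist_def hom_simps mult.assoc)
qed

lemma aexp_H: "H * aexp (scal k * H) = aexp (scal k * H) * H"
  by (rule aexp_linear_commute[symmetric]) (rule scal_central)

lemma aexp_H2: "H * aexp (- 2 * H) = aexp (- 2 * H) * H"
  using aexp_H[of "- 2"] by (simp add: scal_uminus scal_numeral)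

lemma expm1_H2: "H * expm1 (- 2 * H) = expm1 (- 2 * H) * H"
  by (rule expm1_mult_eigen[symmetric]) (simp add: mult_2 algebra_simps)

section \<open>Symmetry of the twisted coproduct on each generator\<close>

lemma twist_D: "twist f g * (g D + f D * g (aexp (- 2 * H))) = (f D + g D) * twist f g"
proof -
  let ?t = "aexp (- 2 * H)"
  have "H * D = D * H + - expm1 (- 2 * H)" by (simp add: gen_relations(3))
  then have "twist f g * g D = (g D + f D * g (a\<^sub>2 * - expm1 (- 2 * H))) * twist f g"
    by (rule twist_mult_g) (simp add: expm1_H2[simplified])
  \<comment> \<open>This identity makes the commutator term cancel the exponential in the coproduct
    of \<open>D\<close>, leaving the primitive form.\<close>
  also have "a\<^sub>2 * - expm1 (- 2 * H) = 1 - ?t"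
    by (simp add: aexp_eq_expm1)
  also have "g (1 - ?t) = 1 - g ?t"
    by (simp only: hom_simps)
  finally have "twist f g * g D = (g D + f D * (1 - g ?t)) * twist f g" .
  moreover have "twist f g * (f D * g ?t) = f D * g ?t * twist f g"
    by (rule twist_commute) (simp_all add: aexp_H2[simplified])
  ultimately show ?thesis
    by (simp only: distrib_left) (simp add: algebra_simps)
qed

lemma twist_P: "twist f g * (g P + f P * g (aexp H)) = (f P + g P) * twist f g"
proof -
  have "twist f g * g P = g P * twist f g"
    using twist_commute[of 1 P] by (simp add: gen_relations hom_simps)
  \<comment> \<open>\<open>P\<close> has weight -1 under \<open>[D, _]\<close>, so the twist
    produces \<open>exp(- a\<^sub>2 H)\<close> in the other leg, inverse to the factor in the
    coproduct.\<close>
  moreover have "twist f g * (f P * g (aexp H)) = f P * twist f g"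
  proof (rule eigen_cancel)
    show "twist f g * f P = f P * g (aexp (- H)) * twist f g"
      using twist_mult_f[of P "- 1"] by (simp add: gen_relations scal_uminus)
    show "twist f g * g (aexp H) = g (aexp H) * twist f g"
      using twist_commute[of 1 "aexp H"] aexp_H[of 1] by (simp add: hom_simps)
  qed (simp add: hom_simps)
  ultimately show ?thesis
    by (simp add: distrib_left distrib_right add.commute)
qed

text \<open>The weight 1 of \<open>K\<close> absorbs its exponential factor, while the commutator of
  \<open>H\<close> with \<open>K\<close> in the second leg is cancelled by the third term of the
  coproduct.\<close>

lemma twist_K:
  "twist f g * (g K + f K * g (aexp (- H)) + a\<^sub>2 * (f D * g (aexp (- 2 * H) * P)))
    = (f K + g K) * twist f g"
proof -
  let ?w = "aexp (- 2 * H) * P"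
  have w: "H * ?w = ?w * H"
    by (metis aexp_H2 gen_relations(7) mult.assoc)
  have "H * K = K * H + - ?w" by (simp add: gen_relations)
  then have "twist f g * g K = (g K + f D * g (a\<^sub>2 * - ?w)) * twist f g"
    by (rule twist_mult_g) (metis w mult_minus_left mult_minus_right)
  also have "f D * g (a\<^sub>2 * - ?w) = - (a\<^sub>2 * (f D * g ?w))"
    by (simp only: hom_simps scal_left_commute mult_minus_right)
  finally have "twist f g * g K = (g K - a\<^sub>2 * (f D * g ?w)) * twist f g" by simp
  moreover have "twist f g * (a\<^sub>2 * (f D * g ?w)) = a\<^sub>2 * (f D * g ?w) * twist f g"
    unfolding scal_left_commute[of "twist f g"] mult.assoc[of "a\<^sub>2"]
    by (simp only: twist_commute[of D ?w, OF refl w])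
  moreover have "twist f g * (f K * g (aexp (- H))) = f K * twist f g"
  proof (rule eigen_cancel)
    show "twist f g * f K = f K * g (aexp H) * twist f g"
      using twist_mult_f[of K 1] by (simp add: gen_relations)
    show "twist f g * g (aexp (- H)) = g (aexp (- H)) * twist f g"
      using twist_commute[of 1 "aexp (- H)"] aexp_H[of "- 1"] by (simp add: hom_simps scal_uminus)
  qed (simp add: hom_simps)
  ultimately show ?thesis
    by (simp only: distrib_left distrib_right left_diff_distrib) simp
qed

lemma twist_M: "twist f g * (g M + f M) = (f M + g M) * twist f g"
  using twist_commute[of M 1] twist_commute[of 1 M]
  by (simp add: gen_relations hom_simps distrib_left distrib_right add.commute)

text \<open>\<open>[D, H]\<close> is not linear in \<open>H\<close>, but $E = (e^{2 a_2 H} - 1) / a_2$ is an eigenvector of \<open>[D, _]\<close>.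
  The intertwining property is therefore shown for \<open>E\<close> and carried over to \<open>H\<close> by \<open>expm1_inject\<close>.\<close>

lemma D_expm1_H: "D * expm1 (2 * H) = expm1 (2 * H) * D + scal (- 2) * expm1 (2 * H)"
proof -
  let ?w = "expm1 (- 2 * H)"
  have "D * (2 * H) = 2 * H * D + 2 * ?w"
    by (simp add: gen_relations(3) distrib_left mult_2 distrib_right)
  moreover have "2 * H * (2 * ?w) = 2 * ?w * (2 * H)"
    using expm1_H2 by (simp add: mult_2 distrib_left distrib_right)
  ultimately have "D * expm1 (2 * H) = expm1 (2 * H) * D + 2 * ?w * aexp (2 * H)"
    by (rule expm1_commutator)
  then show ?thesis
    using expm1_minus[of "2 * H"] by (simp add: mult.assoc scal_uminus scal_numeral)
qed

text \<open>\<open>expm1_add\<close> writes the left factor in the shape of a coproduct with an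
  exponential tail, and \<open>E\<close> has weight -2, so the argument is the one for
  \<open>P\<close>.\<close>

lemma twist_expm1_H:
  "twist f g * expm1 (2 * (f H + g H)) = (expm1 (2 * f H) + expm1 (2 * g H)) * twist f g"
proof -
  let ?E = "expm1 (2 * H)"
  have E: "expm1 (2 * f H) = f ?E" "expm1 (2 * g H) = g ?E" "aexp (2 * g H) = g (aexp (2 * H))"
    by (simp_all add: hom_simps alg_hom_expm1[OF hom(1)] alg_hom_expm1[OF hom(2)])
  have "expm1 (2 * (f H + g H)) = f ?E * g (aexp (2 * H)) + g ?E"
    unfolding distrib_left E[symmetric]
    by (rule expm1_add) (simp add: mult_2 distrib_left distrib_right comm)
  moreover have "twist f g * (f ?E * g (aexp (2 * H))) = f ?E * twist f g"
  proof (rule eigen_cancel)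
    show "twist f g * f ?E = f ?E * g (aexp (- 2 * H)) * twist f g"
      using twist_mult_f[OF D_expm1_H] by (simp add: scal_uminus scal_numeral)
    show "twist f g * g (aexp (2 * H)) = g (aexp (2 * H)) * twist f g"
      using twist_commute[of 1 "aexp (2 * H)"] aexp_H[of 2] by (simp add: hom_simps scal_numeral)
  qed (simp add: hom_simps)
  moreover have "twist f g * g ?E = g ?E * twist f g"
    using twist_commute[of 1 ?E] expm1_mult_eigen[of "2 * H" H "2 * H"]
    by (simp add: hom_simps mult_2 distrib_left distrib_right)
  ultimately show ?thesis
    unfolding E by (simp add: distrib_left distrib_right)
qed

text \<open>Two commutators act on the second leg and leave \<open>a\<^sub>2 * (f D * g D)\<close>
  and the excess \<open>q - q * t\<close>. In the first leg \<open>C\<close> splits into the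
  eigenvector \<open>C'\<close> and \<open>q\<close>; the remaining \<open>q\<close> and
  \<open>q * t\<close> restore \<open>f C\<close> and cancel the excess.\<close>

lemma twist_C:
  "twist f g * (g C + f C * g (aexp (- 2 * H))) = (f C + g C + a\<^sub>2 * (f D * g D)) * twist f g"
proof -
  define t where "t = g (aexp (- 2 * H))"
  define h :: "'w calg" where "h = scal (fps_const (1 / 2))"
  define h' :: schr where "h' = scal (fps_const (1 / 2))"
  have half: "h + h = 1" "h' + h' = 1"
    by (simp_all add: h_def h'_def flip: scal_add)
  have h_comm: "x * (h * y) = h * (x * y)" for x y unfolding h_def by (rule scal_left_commute)
  have h'_comm: "x * (h' * y) = h' * (x * y)" for x y unfolding h'_def by (rule scal_left_commute)
  have f_h: "f (h' * x) = h * f x" for x unfolding h_def h'_def by (rule alg_hom_scal_mult[OF hom(1)])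
  let ?e = "expm1 (- 2 * H)"
  let ?v = "- h * (f (D * D) * g ?e)"
  have 1: "twist f g * g C = (g C + a\<^sub>2 * (f D * g D) + a\<^sub>2 * (a\<^sub>2 * ?v)) * twist f g"
    unfolding twist_def
  proof (rule aexp_mult_nilpotent)
    show "f D * g H * g C = g C * (f D * g H) + f D * g D"
      unfolding fg gen_relations(5) by (simp only: hom_simps distrib_left)
    have "?v + ?v = - ((h + h) * (f (D * D) * g ?e))"
      by (simp add: distrib_right)
    then have v: "?v + ?v = - (f (D * D) * g ?e)" by (simp add: half)
    have HD: "H * D = D * H - ?e" by (simp add: gen_relations(3))
    show "f D * g H * (f D * g D) = f D * g D * (f D * g H) + ?v + ?v"
      unfolding fg HD add.assoc v by (simp only: hom_simps right_diff_distrib) simp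
    show "f D * g H * ?v = ?v * (f D * g H)"
      unfolding mult_minus_left mult_minus_right h_comm mult.assoc[of h] fg expm1_H2
      by (simp add: mult.assoc expm1_H2[simplified])
  qed
  \<comment> \<open>One factor \<open>a\<^sub>2\<close> is spent on turning
    \<open>expm1 (- 2 * H)\<close> into a difference of exponentials.\<close>
  have 2: "a\<^sub>2 * (a\<^sub>2 * ?v) = a\<^sub>2 * (h * (f (D * D) * (1 - t)))"
  proof -
    have t: "1 - t = - (a\<^sub>2 * g ?e)"
      unfolding t_def aexp_eq_expm1 by (simp only: hom_simps) simp
    show ?thesis
      unfolding t by (simp only: mult_minus_left mult_minus_right scal_left_commute[of "f (D * D)"]
          scal_left_commute[of h])
  qed
  have 3: "twist f g * t = t * twist f g"
    using twist_commute[of 1 "aexp (- 2 * H)"] aexp_H2 by (simp add: hom_simps t_def)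
  have 4: "twist f g * f (D * D) = f (D * D) * twist f g"
    using twist_commute[of "D * D" 1] by (simp add: hom_simps mult.assoc)
  \<comment> \<open>an eigenvector of \<open>[D, _]\<close>\<close>
  define C' where "C' = C - h' * (a\<^sub>2 * (D * D))"
  have 5: "twist f g * (f C' * t) = f C' * twist f g"
  proof (rule eigen_cancel)
    let ?q = "h' * (a\<^sub>2 * (D * D))"
    have "D * ?q = ?q * D"
      by (simp only: h'_comm[of D] scal_left_commute[of D] mult.assoc)
    moreover have "scal 2 * ?q = a\<^sub>2 * (D * D)"
      using half(2) by (simp add: scal_numeral mult_2 flip: mult.assoc distrib_right)
    ultimately have "D * C' = C' * D + scal 2 * C'"
      unfolding C'_def right_diff_distrib left_diff_distrib gen_relations(4)
      by (simp add: scal_numeral)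
    then show "twist f g * f C' = f C' * g (aexp (2 * H)) * twist f g"
      using twist_mult_f[of C' 2] by (simp add: scal_numeral)
  qed (use 3 in \<open>simp_all add: t_def hom_simps\<close>)
  define q where "q = a\<^sub>2 * (h * f (D * D))"
  have fC: "f C = f C' + q"
    by (simp add: C'_def q_def alg_hom_diff[OF hom(1)] f_h alg_hom_scal_mult[OF hom(1)] scal_left_commute[of h])
  have q: "twist f g * q = q * twist f g"
    by (simp only: q_def scal_left_commute[of "twist f g"] h_comm[of "twist f g"] 4 mult.assoc)
  have 6: "twist f g * (q * t) = q * t * twist f g"
    using q 3 by (metis mult.assoc)
  have 8: "a\<^sub>2 * (h * (f (D * D) * (1 - t))) = q - q * t"
    by (simp add: q_def right_diff_distrib mult.assoc)
  have 7: "twist f g * g C = (g C + a\<^sub>2 * (f D * g D) + (q - q * t)) * twist f g"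
    using 1 unfolding 2 8 .
  show ?thesis
    unfolding t_def[symmetric] fC distrib_left distrib_right 7 5 6 left_diff_distrib
    by (simp add: algebra_simps)
qed

text \<open>Applied with \<open>u\<close> a coproduct, \<open>v\<close> its flip and
  \<open>s\<close> the symmetric twisted coproduct: one twist leads from \<open>u\<close> to
  \<open>s\<close>, the inverse of the flipped twist from \<open>s\<close> to
  \<open>v\<close>.\<close>

lemma Rmat_intertwine:
  assumes "twist f g * u = s * twist f g" "twist g f * v = s * twist g f"
  shows "Rmat f g * u = v * Rmat f g"
  using inverse_intertwine[OF twist_inv assms(2)] assms(1)
  by (metis Rmat_def mult.assoc)

lemma Rmat_D: "Rmat f g * (g D + f D * g (aexp (- 2 * H))) = (f D + g D * f (aexp (- 2 * H))) * Rmat f g"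
  using commuting_pair.twist_D[OF swap] by (intro Rmat_intertwine[OF twist_D]) (simp add: add.commute)

lemma Rmat_P: "Rmat f g * (g P + f P * g (aexp H)) = (f P + g P * f (aexp H)) * Rmat f g"
  using commuting_pair.twist_P[OF swap] by (intro Rmat_intertwine[OF twist_P]) (simp add: add.commute)

lemma Rmat_K:
  "Rmat f g * (g K + f K * g (aexp (- H)) + a\<^sub>2 * (f D * g (aexp (- 2 * H) * P)))
    = (f K + g K * f (aexp (- H)) + a\<^sub>2 * (g D * f (aexp (- 2 * H) * P))) * Rmat f g"
  using commuting_pair.twist_K[OF swap]
  by (intro Rmat_intertwine[OF twist_K]) (simp add: add.commute)

lemma Rmat_C: "Rmat f g * (g C + f C * g (aexp (- 2 * H))) = (f C + g C * f (aexp (- 2 * H))) * Rmat f g"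
  using commuting_pair.twist_C[OF swap]
  by (intro Rmat_intertwine[OF twist_C]) (simp add: add.commute comm)

lemma Rmat_M: "Rmat f g * (g M + f M) = (f M + g M) * Rmat f g"
  using commuting_pair.twist_M[OF swap] by (intro Rmat_intertwine[OF twist_M]) (simp add: add.commute)

lemma Rmat_inverse: "Rmat f g * Rmat g f = 1"
  by (simp add: Rmat_def mult.assoc)

text \<open>The R-matrix commutes with \<open>expm1 ?z\<close>. As \<open>expm1\<close> is
  compatible with conjugation, \<open>?z\<close> and its conjugate have the same
  \<open>expm1\<close>, hence coincide by \<open>expm1_inject\<close>; finally the factor 2 is
  cancelled.\<close>

lemma Rmat_H: "Rmat f g * (g H + f H) = (f H + g H) * Rmat f g"
proof -
  let ?R = "Rmat f g" and ?R' = "Rmat g f" and ?z = "2 * (f H + g H)"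
  have inv: "?R' * ?R = 1" by (rule commuting_pair.Rmat_inverse[OF swap])
  have "?R * expm1 ?z = expm1 ?z * ?R"
    using commuting_pair.twist_expm1_H[OF swap]
    by (intro Rmat_intertwine[OF twist_expm1_H]) (simp add: add.commute)
  moreover have "expm1 (?R * ?z * ?R') * ?R = ?R * expm1 ?z"
    by (rule expm1_mult_eigen) (simp add: inv mult.assoc)
  ultimately have "expm1 (?R * ?z * ?R') * (?R * ?R') = expm1 ?z * (?R * ?R')"
    by (simp flip: mult.assoc)
  then have "?R * ?z * ?R' = ?z"
    unfolding Rmat_inverse mult_1_right by (rule expm1_inject)
  then have "?R * ?z = ?z * ?R"
    by (metis inv mult.assoc mult.right_neutral)
  moreover have "?R * (2 * (f H + g H)) = 2 * (?R * (f H + g H))"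
    by (simp add: mult_2 distrib_left)
  ultimately have "2 * (?R * (f H + g H)) = 2 * ((f H + g H) * ?R)"
    by (simp only: mult.assoc)
  then have "?R * (f H + g H) = (f H + g H) * ?R"
    using of_nat_cancel[of 1] by simp
  then show ?thesis by (simp add: add.commute)
qed

lemma Rmat_commute:
  assumes "\<And>x. z * f x = f x * z" "\<And>x. z * g x = g x * z"
  shows "Rmat f g * z = z * Rmat f g"
proof -
  have "f x * g y * z = z * (f x * g y)" "g x * f y * z = z * (g x * f y)" for x y
    using assms by (metis mult.assoc)+
  then have "twist f g * z = z * twist f g" "twist_inv g f * z = z * twist_inv g f"
    unfolding twist_def twist_inv_def by (intro aexp_commute; simp)+
  then show ?thesis unfolding Rmat_def by (metis mult.assoc)
qed

end

section \<open>Three commuting legs: hexagon identities and the Yang--Baxter equation\<close>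

locale commuting_triple =
  p12: commuting_pair f1 f2 + p13: commuting_pair f1 f3 + p23: commuting_pair f2 f3
  for f1 f2 f3 :: "schr \<Rightarrow> 'w::presentation calg"
begin

lemma swap12: "commuting_triple f2 f1 f3" and swap23: "commuting_triple f1 f3 f2"
  and rotate: "commuting_triple f3 f1 f2"
  unfolding commuting_triple_def
  using p12.swap p13.swap p23.swap p12.commuting_pair_axioms p13.commuting_pair_axioms
    p23.commuting_pair_axioms by auto

lemma comm: "f2 y * f1 x = f1 x * f2 y" "f3 y * f1 x = f1 x * f3 y" "f3 y * f2 x = f2 x * f3 y"
  by (rule p12.comm p13.comm p23.comm)+

lemmas comm_left = p12.comm_left p13.comm_left p23.comm_left

lemma first_commute: "f1 x * f2 y * (f1 x * f3 z) = f1 x * f3 z * (f1 x * f2 y)"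
  by (rule mult_commute_mult) (simp_all add: comm)

lemma second_commute: "f1 x * f3 z * (f2 y * f3 z) = f2 y * f3 z * (f1 x * f3 z)"
  by (rule mult_commute_mult) (simp_all add: comm)

lemma twist_first_commute: "twist f1 f2 * twist f1 f3 = twist f1 f3 * twist f1 f2"
  and twist_inv_first_commute: "twist_inv f1 f2 * twist_inv f1 f3 = twist_inv f1 f3 * twist_inv f1 f2"
  unfolding twist_def twist_inv_def by (rule aexp_commute2, simp add: first_commute)+

lemma twist_second_commute: "twist f1 f3 * twist f2 f3 = twist f2 f3 * twist f1 f3"
  and twist_inv_second_commute: "twist_inv f1 f3 * twist_inv f2 f3 = twist_inv f2 f3 * twist_inv f1 f3"
  unfolding twist_def twist_inv_def by (rule aexp_commute2, simp add: second_commute)+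

lemma twist_mult_first:
  "twist f1 f2 * twist f1 f3 = aexp (f1 (gen gD) * (f2 (gen gH) + f3 (gen gH)))"
  unfolding twist_def distrib_left by (rule aexp_add[symmetric]) (rule first_commute)

lemma twist_inv_mult_first:
  "twist_inv f1 f2 * twist_inv f1 f3 = aexp (- (f1 (gen gD) * (f2 (gen gH) + f3 (gen gH))))"
  unfolding twist_inv_def distrib_left minus_add_distrib
  by (rule aexp_add[symmetric]) (simp add: first_commute)

lemma twist_mult_second:
  "twist f1 f3 * twist f2 f3 = aexp ((f1 (gen gD) + f2 (gen gD)) * f3 (gen gH))"
  unfolding twist_def distrib_right by (rule aexp_add[symmetric]) (rule second_commute)

lemma Rmat_twist_commute:
  "Rmat f2 f3 * (twist f1 f2 * twist f1 f3) = twist f1 f2 * twist f1 f3 * Rmat f2 f3"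
  unfolding twist_mult_first
proof (rule aexp_commute[symmetric])
  have 1: "Rmat f2 f3 * f1 x = f1 x * Rmat f2 f3" for x
    by (rule p23.Rmat_commute) (simp_all add: comm)
  show "f1 (gen gD) * (f2 (gen gH) + f3 (gen gH)) * Rmat f2 f3
    = Rmat f2 f3 * (f1 (gen gD) * (f2 (gen gH) + f3 (gen gH)))"
    using 1 p23.Rmat_H by (metis add.commute mult.assoc)
qed

text \<open>The left side is \<open>(\<Delta> \<otimes> id) F\<close>. By \<open>twist_D\<close>,
  \<open>F_12\<close> conjugates the coproduct of \<open>D\<close> to \<open>D_1 + D_2\<close> and
  leaves \<open>H_3\<close> fixed, so it conjugates the whole exponential to
  \<open>F_13 F_23\<close>.\<close>

lemma twist_coproduct:
  "aexp ((f2 (gen gD) + f1 (gen gD) * f2 (aexp (- 2 * gen gH))) * f3 (gen gH))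
    = twist_inv f1 f2 * (twist f1 f3 * twist f2 f3 * twist f1 f2)" (is "aexp (?\<Delta>D * ?H) = _")
proof -
  have "twist f1 f2 * ?H = ?H * twist f1 f2"
    unfolding twist_def by (rule aexp_commute) (simp add: mult.assoc comm comm_left)
  with p12.twist_D have "(f1 (gen gD) + f2 (gen gD)) * ?H * twist f1 f2 = twist f1 f2 * (?\<Delta>D * ?H)"
    by (metis mult.assoc)
  from aexp_mult_eigen[OF this] show ?thesis
    by (simp add: twist_mult_second)
qed

text \<open>To move \<open>F_13\<close> past \<open>R_23\<close>, the pair
  \<open>F_12\<inverse> F_12\<close> is inserted, since it is the product \<open>F_12 F_13\<close>
  that commutes with \<open>R_23\<close>.\<close>

lemma Rmat_mult_Rmat:
  "Rmat f1 f3 * Rmat f2 f3 = twist_inv f3 f1 * twist_inv f3 f2 *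
    (twist_inv f1 f2 * (twist f1 f3 * twist f2 f3 * twist f1 f2))"
proof -
  let ?a = "twist f1 f2" and ?a' = "twist_inv f1 f2" and ?b = "twist f1 f3" and ?c = "twist f2 f3"
    and ?e' = "twist_inv f3 f2"
  have a'e': "?a' * ?e' = ?e' * ?a'"
    by (rule commuting_triple.twist_inv_second_commute[OF swap23])
  have "?a' * (?e' * ?c * (?a * ?b)) = ?b * (?e' * ?c)"
    using Rmat_twist_commute by (simp add: Rmat_def mult.assoc)
  then have "?b * (?e' * ?c) = ?a' * (?e' * (?c * ?b * ?a))"
    by (simp add: twist_first_commute mult.assoc)
  also have "\<dots> = ?e' * (?a' * (?b * ?c * ?a))"
    by (simp add: twist_second_commute a'e' flip: mult.assoc)
  finally show ?thesis by (simp add: Rmat_def mult.assoc)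
qed

text \<open>The left side is \<open>(\<Delta> \<otimes> id) R\<close> on the three legs; its two
  factors are the two blocks on the right of \<open>Rmat_mult_Rmat\<close>.\<close>

lemma coproduct_first_Rmat:
  "aexp (- ((f1 (gen gH) + f2 (gen gH)) * f3 (gen gD)))
    * aexp ((f2 (gen gD) + f1 (gen gD) * f2 (aexp (- 2 * gen gH))) * f3 (gen gH))
    = Rmat f1 f3 * Rmat f2 f3"
proof -
  have "f3 (gen gD) * (f1 (gen gH) + f2 (gen gH)) = (f1 (gen gH) + f2 (gen gH)) * f3 (gen gD)"
    by (simp add: comm distrib_left distrib_right)
  with commuting_triple.twist_inv_mult_first[OF rotate]
  show ?thesis unfolding Rmat_mult_Rmat twist_coproduct by simp
qed

text \<open>The left side is \<open>(id \<otimes> \<Delta>) R\<close>. Its first exponential is the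
  inverse of a twisted coproduct with the legs taken in the order 2, 3, 1.\<close>

lemma coproduct_second_Rmat:
  "aexp (- (f1 (gen gH) * (f3 (gen gD) + f2 (gen gD) * f3 (aexp (- 2 * gen gH)))))
    * aexp (f1 (gen gD) * (f2 (gen gH) + f3 (gen gH)))
    = Rmat f1 f3 * Rmat f1 f2"
proof -
  let ?a = "twist f1 f2" and ?b = "twist f1 f3" and ?c = "twist f2 f3"
    and ?d = "twist f3 f1" and ?g = "twist f2 f1"
    and ?c' = "twist_inv f2 f3" and ?d' = "twist_inv f3 f1" and ?g' = "twist_inv f2 f1"
  interpret r: commuting_triple f2 f3 f1
    using commuting_triple.rotate[OF rotate] .
  interpret s: commuting_triple f2 f1 f3 by (rule swap12)
  have bc: "?c * (?b * x) = ?b * (?c * x)" for x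
    by (simp add: twist_second_commute flip: mult.assoc)
  let ?x = "(f3 (gen gD) + f2 (gen gD) * f3 (aexp (- 2 * gen gH))) * f1 (gen gH)"
  have "aexp ?x * (?c' * (?d' * ?g') * ?c) = 1"
    unfolding r.twist_coproduct by (simp add: mult.assoc)
  then have "aexp (- ?x) = ?c' * (?d' * ?g') * ?c"
    by (metis aexp_minus(1) mult.assoc mult_1 mult_1_right)
  moreover have "?d' * ?g' = ?g' * ?d'"
    by (rule r.twist_inv_second_commute[symmetric])
  moreover have "f1 (gen gH) * (f3 (gen gD) + f2 (gen gD) * f3 (aexp (- 2 * gen gH))) = ?x"
    by (simp add: distrib_left distrib_right mult.assoc comm comm_left)
  ultimately have "aexp (- (f1 (gen gH) * (f3 (gen gD) + f2 (gen gD) * f3 (aexp (- 2 * gen gH)))))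
      * aexp (f1 (gen gD) * (f2 (gen gH) + f3 (gen gH))) = ?c' * (?g' * ?d') * ?c * (?b * ?a)"
    by (simp add: twist_mult_first[symmetric] twist_first_commute)
  also have "\<dots> = ?c' * ?g' * (?d' * ?b) * (?c * ?a)"
    by (simp add: mult.assoc bc)
  \<comment> \<open>\<open>R_13\<close> commutes with \<open>F_21 F_23\<close>, hence with its
    inverse. With \<open>R_13\<close> in front, the factors \<open>F_23\<close> cancel and
    \<open>R_12\<close> remains.\<close>
  also have "?c' * ?g' * (?d' * ?b) = (?d' * ?b) * (?c' * ?g')"
  proof (rule inverse_intertwine)
    show "?g * ?c * (?d' * ?b) = ?d' * ?b * (?g * ?c)"
      using s.Rmat_twist_commute by (simp add: Rmat_def)
  qed (simp_all add: mult.assoc)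
  also have "?c' * ?g' = ?g' * ?c'"
    by (rule s.twist_inv_first_commute[symmetric])
  finally show ?thesis by (simp add: Rmat_def mult.assoc)
qed

text \<open>\<open>R_12\<close> commutes with \<open>F_31 F_32\<close>, hence with the inverse block
  in \<open>Rmat_mult_Rmat\<close>. It then meets \<open>F_12\<inverse>\<close> and becomes
  \<open>F_21\<inverse>\<close>, which yields the same factorization with legs 1 and 2
  exchanged.\<close>

lemma Rmat_yang_baxter: "Rmat f1 f2 * Rmat f1 f3 * Rmat f2 f3 = Rmat f2 f3 * Rmat f1 f3 * Rmat f1 f2"
proof -
  let ?a = "twist f1 f2" and ?b = "twist f1 f3" and ?c = "twist f2 f3"
    and ?d = "twist f3 f1" and ?e = "twist f3 f2"
    and ?d' = "twist_inv f3 f1" and ?e' = "twist_inv f3 f2" and ?g' = "twist_inv f2 f1"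
  interpret r: commuting_triple f3 f1 f2 by (rule rotate)
  interpret s: commuting_triple f2 f1 f3 by (rule swap12)
  have "?e' * ?d' * Rmat f1 f2 = Rmat f1 f2 * (?e' * ?d')"
    by (rule inverse_intertwine[of "?d * ?e"]) (simp_all add: mult.assoc r.Rmat_twist_commute[symmetric, simplified mult.assoc])
  moreover have "?d' * ?e' = ?e' * ?d'"
    by (rule r.twist_inv_first_commute)
  ultimately have "Rmat f1 f2 * (Rmat f1 f3 * Rmat f2 f3)
      = ?e' * ?d' * (Rmat f1 f2 * (twist_inv f1 f2 * (?b * ?c * ?a)))"
    unfolding Rmat_mult_Rmat by (simp flip: mult.assoc)
  also have "\<dots> = ?e' * ?d' * (?g' * (?c * ?b * ?a))"
    by (simp add: Rmat_def mult.assoc twist_second_commute)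
  also have "\<dots> = Rmat f2 f3 * Rmat f1 f3 * Rmat f1 f2"
    unfolding s.Rmat_mult_Rmat by (simp add: Rmat_def mult.assoc)
  finally show ?thesis by (simp add: mult.assoc)
qed

end

section \<open>Reduction to generators, the first-order term and the conclusion\<close>

lemma mon_Word_induct [case_names empty Cons]:
  assumes "Q (1 :: schr)" "\<And>g x. Q x \<Longrightarrow> Q (gen g * x)"
  shows "Q (mon w)"
proof -
  have "Q (mon (Word gs))" for gs
  proof (induction gs)
    case Nil
    then show ?case using assms(1) by (simp flip: zero_schr_word_def)
  next
    case (Cons g gs)
    have "mon (Word (g # gs)) = gen g * mon (Word gs)"
      using mon_add[of "Word [g]" "Word gs"] by (simp add: gen_def fgen_def mon_def)
    with Cons assms(2) show ?case by simp
  qed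
  then show ?thesis by (cases w) simp
qed

text \<open>\<open>r\<close> is pushed through a word one generator at a time; linearity extends the
  identity from words to the completed algebra.\<close>

lemma alg_hom_intertwineI:
  fixes \<phi> \<psi> :: "schr \<Rightarrow> 'w::presentation calg"
  assumes "alg_hom \<phi>" "alg_hom \<psi>" and gen: "\<And>g. r * \<phi> (gen g) = \<psi> (gen g) * r"
  shows "r * \<phi> x = \<psi> x * r"
proof (rule fun_cong[of _ _ x], rule clinear_eqI)
  show "r * \<phi> (mon w) = \<psi> (mon w) * r" for w
  proof (induction w rule: mon_Word_induct)
    case (Cons g x)
    have "r * \<phi> (gen g * x) = r * \<phi> (gen g) * \<phi> x"
      by (simp add: alg_hom_mult[OF assms(1)] mult.assoc)
    also have "\<dots> = \<psi> (gen g) * (r * \<phi> x)"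
      by (simp add: gen mult.assoc)
    finally show ?case
      by (simp add: Cons alg_hom_mult[OF assms(2)] mult.assoc)
  qed (simp add: alg_hom_1 assms)
qed (rule clinear_mult_left[OF assms(1)] clinear_mult_right[OF assms(2)])+

lemma cinv_eqI:
  assumes "x * y = 1" "y * x = 1" shows "cinv x = y"
  unfolding cinv_def
proof (rule the_equality)
  show "z = y" if "x * z = 1 \<and> z * x = 1" for z
    using that assms by (metis mult.assoc mult_1 mult_1_right)
qed (use assms in blast)

lemma aexp_first_order: "\<exists>y. aexp x = 1 + a\<^sub>2 * x + a\<^sub>2\<^sup>2 * y"
proof -
  have "fps_shift 1 (expS x) $ 0 = x" by (simp add: expS_def)
  then have "aexp x = 1 + a\<^sub>2 * (x + a\<^sub>2 * aeval (fps_shift 1 (fps_shift 1 (expS x))))"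
    using aexp_eq_expm1[of x] aeval_unfold[of "fps_shift 1 (expS x)"] by (simp add: expm1_def)
  then show ?thesis
    by (auto simp: distrib_left power2_eq_square mult.assoc)
qed

lemma classical_r_matrix_aexp: "classical_r_matrix (aexp (- u) * aexp v) (a\<^sub>2 * (v - u))"
proof -
  obtain y z where y: "aexp (- u) = 1 + a\<^sub>2 * - u + a\<^sub>2\<^sup>2 * y" and z: "aexp v = 1 + a\<^sub>2 * v + a\<^sub>2\<^sup>2 * z"
    using aexp_first_order by metis
  have "u * aexp v = u + a\<^sub>2 * (u * v + a\<^sub>2 * (u * z))"
    unfolding z power2_eq_square distrib_left mult.assoc scal_left_commute[of u] by simp
  moreover have "aexp (- u) * aexp v = aexp v - a\<^sub>2 * (u * aexp v) + a\<^sub>2\<^sup>2 * (y * aexp v)"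
    unfolding y by (simp add: distrib_right left_diff_distrib mult.assoc)
  ultimately have "aexp (- u) * aexp v
      = 1 + a\<^sub>2 * (v - u) + a\<^sub>2\<^sup>2 * (z - u * v - a\<^sub>2 * (u * z) + y * aexp v)"
    by (simp only: z power2_eq_square) (simp add: distrib_left right_diff_distrib mult.assoc)
  then show ?thesis unfolding classical_r_matrix_def by blast
qed

theorem mainTheorem11:
  fixes \<Delta> :: "schr \<Rightarrow> (schr_word \<times> schr_word) calg"
    and \<epsilon> :: "schr \<Rightarrow> real fps"
    and S :: "schr \<Rightarrow> schr"
    and D H P K C M :: schr
    and R :: "(schr_word \<times> schr_word) calg"
  defines "D \<equiv> gen gD" and "H \<equiv> gen gH" and "P \<equiv> gen gP"
    and "K \<equiv> gen gK" and "C \<equiv> gen gC" and "M \<equiv> gen gM"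
  defines "R \<equiv> aexp (- (H \<otimes> D)) * aexp (D \<otimes> H)"
  assumes "hopf_algebra \<Delta> \<epsilon> S"
    and "\<Delta> H = 1 \<otimes> H + H \<otimes> 1"
    and "\<Delta> M = 1 \<otimes> M + M \<otimes> 1"
    and "\<Delta> D = 1 \<otimes> D + D \<otimes> aexp (- 2 * H)"
    and "\<Delta> C = 1 \<otimes> C + C \<otimes> aexp (- 2 * H)"
    and "\<Delta> P = 1 \<otimes> P + P \<otimes> aexp H"
    and "\<Delta> K = 1 \<otimes> K + K \<otimes> aexp (- H) + a\<^sub>2 * (D \<otimes> (aexp (- 2 * H) * P))"
  shows "triangular_universal_R_matrix \<Delta> R
    \<and> quantum_yang_baxter R
    \<and> (\<forall>X. R * \<Delta> X * cinv R = flip (\<Delta> X))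
    \<and> classical_r_matrix R (a\<^sub>2 * wedge D H)"
proof -
  note \<Delta> = assms(9-14)
  have hom_\<Delta>: "alg_hom \<Delta>" using assms(8) by (simp add: hopf_algebra_def)
  define f :: "schr \<Rightarrow> (schr_word \<times> schr_word) calg" where "f = cmap (\<lambda>v. (v, 0))"
  define g :: "schr \<Rightarrow> (schr_word \<times> schr_word) calg" where "g = cmap (\<lambda>w. (0, w))"
  interpret p: commuting_pair f g
    by unfold_locales (simp_all add: f_def g_def alg_hom_inl alg_hom_inr inl_inr_commute)
  interpret t: commuting_triple in1 in2 in3
    by unfold_locales (simp_all add: alg_hom_in in_commute)
  have tens: "x \<otimes> y = f x * g y" for x y by (simp add: tens_def f_def g_def)
  have f1: "f 1 = 1" and g1: "g 1 = 1" by (simp_all add: p.hom_simps)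
  \<comment> \<open>Since the legs commute, \<open>H \<otimes> D\<close> equals
    \<open>g D * f H\<close>, so the first exponential is \<open>twist_inv g f\<close>.\<close>
  have R: "R = Rmat f g"
    by (simp add: R_def Rmat_def twist_def twist_inv_def tens p.comm D_def H_def)
  have R_inv: "R * Rmat g f = 1" "Rmat g f * R = 1"
    unfolding R by (rule p.Rmat_inverse, rule commuting_pair.Rmat_inverse[OF p.swap])
  then have cinv: "cinv R = Rmat g f" by (rule cinv_eqI)

  \<comment> \<open>The flip exchanges the legs, so it carries \<open>Rmat f g\<close> to
    \<open>Rmat g f\<close>, which is the inverse.\<close>
  have "flip (f x) = g x" "flip (g x) = f x" for x
    using flip_tens[of x "1 :: schr"] flip_tens[of "1 :: schr" x] by (simp_all add: tens f1 g1)
  note flip = alg_hom_simps[OF alg_hom_leg(5)] alg_hom_aexp[OF alg_hom_leg(5)] this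

  have intertwine: "R * \<Delta> X = flip (\<Delta> X) * R" for X
  proof (rule alg_hom_intertwineI[OF hom_\<Delta> alg_hom_comp[OF alg_hom_leg(5) hom_\<Delta>]])
    fix x
    show "R * \<Delta> (gen x) = flip (\<Delta> (gen x)) * R"
    proof (cases x)
      case gD then show ?thesis
        using p.Rmat_D \<Delta>(3) unfolding R D_def H_def by (simp add: flip tens f1 g1 p.comm)
    next
      case gH then show ?thesis
        using p.Rmat_H \<Delta>(1) unfolding R D_def H_def by (simp add: flip tens f1 g1 p.comm)
    next
      case gP then show ?thesis
        using p.Rmat_P \<Delta>(5) unfolding R P_def H_def by (simp add: flip tens f1 g1 p.comm)
    next
      case gK then show ?thesis
        using p.Rmat_K \<Delta>(6) unfolding R K_def P_def D_def H_def
        by (simp add: flip tens f1 g1 p.comm)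
    next
      case gC then show ?thesis
        using p.Rmat_C \<Delta>(4) unfolding R C_def H_def by (simp add: flip tens f1 g1 p.comm)
    next
      case gM then show ?thesis
        using p.Rmat_M \<Delta>(2) unfolding R M_def by (simp add: flip tens f1 g1 p.comm)
    qed
  qed
  have conj: "R * \<Delta> X * cinv R = flip (\<Delta> X)" for X
    unfolding intertwine cinv by (simp add: R_inv mult.assoc)

  note tmap = alg_hom_tmap[OF hom_\<Delta> alg_hom_id] alg_hom_tmap[OF alg_hom_id hom_\<Delta>]
  note leg = alg_hom_simps[OF alg_hom_leg(1)] alg_hom_simps[OF alg_hom_leg(2)]
    alg_hom_simps[OF alg_hom_leg(3)] leg_tens alg_hom_simps[OF alg_hom_in(1)]
    alg_hom_simps[OF alg_hom_in(2)] alg_hom_simps[OF alg_hom_in(3)]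
  have leg_R: "leg12 R = Rmat in1 in2" "leg13 R = Rmat in1 in3" "leg23 R = Rmat in2 in3"
    by (simp_all add: R_def Rmat_def twist_def twist_inv_def leg alg_hom_aexp alg_hom_leg
        t.comm D_def H_def)
  have "assoc (tmap \<Delta> id R) = leg13 R * leg23 R"
  proof -
    \<comment> \<open>Both maps are algebra homomorphisms and therefore act inside the exponentials,
      on the exponents alone.\<close>
    have "assoc (tmap \<Delta> id R) = aexp (- (leg12 (\<Delta> H) * in3 D)) * aexp (leg12 (\<Delta> D) * in3 H)"
      unfolding R_def
      by (simp add: alg_hom_simps[OF tmap(1)] alg_hom_aexp[OF tmap(1)] tmap_tens hom_\<Delta> alg_hom_id
          alg_hom_simps[OF alg_hom_leg(4)] alg_hom_aexp[OF alg_hom_leg(4)] assoc_tens)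
    also have "leg12 (\<Delta> H) = in1 H + in2 H"
      unfolding \<Delta> by (simp add: leg add.commute)
    also have "leg12 (\<Delta> D) = in2 D + in1 D * in2 (aexp (- 2 * H))"
      unfolding \<Delta> by (simp add: leg add.commute)
    finally show ?thesis
      unfolding leg_R D_def H_def t.coproduct_first_Rmat .
  qed
  moreover have "tmap id \<Delta> R = leg13 R * leg12 R"
  proof -
    have "tmap id \<Delta> R = aexp (- (in1 H * leg23 (\<Delta> D))) * aexp (in1 D * leg23 (\<Delta> H))"
      unfolding R_def
      by (simp add: alg_hom_simps[OF tmap(2)] alg_hom_aexp[OF tmap(2)] tmap_tens hom_\<Delta> alg_hom_id
          tens_leg23)
    also have "leg23 (\<Delta> H) = in2 H + in3 H"
      unfolding \<Delta> by (simp add: leg add.commute)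
    also have "leg23 (\<Delta> D) = in3 D + in2 D * in3 (aexp (- 2 * H))"
      unfolding \<Delta> by (simp add: leg add.commute)
    finally show ?thesis
      unfolding leg_R D_def H_def t.coproduct_second_Rmat .
  qed
  moreover have "cinvertible R" using R_inv by (auto simp: cinvertible_def)
  moreover have "flip R = cinv R"
    unfolding cinv unfolding R Rmat_def twist_def twist_inv_def by (simp add: flip)
  ultimately have "triangular_universal_R_matrix \<Delta> R"
    using conj by (simp add: triangular_universal_R_matrix_def universal_R_matrix_def)
  moreover have "quantum_yang_baxter R"
    unfolding quantum_yang_baxter_def leg_R by (rule t.Rmat_yang_baxter)
  moreover have "classical_r_matrix R (a\<^sub>2 * wedge D H)"
    unfolding R_def wedge_def by (rule classical_r_matrix_aexp)
  ultimately show ?thesis using conj by blast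
qed

end
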